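(* Consider the expansion of the liquid–vapor interface $x(y,z)$: $$x(y,z)=m(z-R)+u(y,z)\,\eta+o(\eta),$$ where $$m=\frac1{r-R}\cdot\frac1{2l_y}\int_{-l_y}^{l_y}f(y)\,dy\qquad\text{and}\qquad\eta=\|f-m(r-R)\|_\infty.$$ Under this expansion, the graphical minimal surface system $$(1+x_y^2)x_{zz}-2x_yx_zx_{yz}+(1+x_z^2)x_{yy}=0,$$ $$x(y,r)=f(y),\qquad x(y,R)=0,\qquad x(-l_y,z)=x(l_y,z),\qquad x_y(-l_y,z)=x_y(l_y,z)$$ is approximated at leading order $O(\eta)$ by $$u_{zz}+(1+m^2)u_{yy}=0,$$ $$u(y,r)=\tfrac1\eta\bigl(f(y)-m(r-R)\bigr),\qquad u(y,R)=0,\qquad u(-l_y,z)=u(l_y,z),\qquad u_y(-l_y,z)=u_y(l_y,z).$$ This linear problem admits the Fourier series solution $$u(y,z)=\frac1\eta\sum_{n=1}^\infty\Bigl[A_n\cos\Bigl(\pi n\frac{y+l_y}{l_y}\Bigr)+B_n\sin\Bigl(\pi n\frac{y+l_y}{l_y}\Bigr)\Bigr]\frac{1}{\sinh\bigl(\frac{2\pi nh}{l}\bigr)}\sinh\Bigl(\pi n\sqrt{1+m^2}\,\frac{R-z}{l_y}\Bigr),$$ where $h=R-r$, $l=\frac{2l_y}{\sqrt{1+m^2}}$, $g(y)=f(\sqrt{1+m^2}\,y-l_y)-m(r-R)$, and the Fourier coefficients are $$A_n=\frac2l\int_0^l g(y)\cos\Bigl(\frac{2\pi ny}{l}\Bigr)dy,\qquad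 B_n=\frac2l\int_0^l g(y)\sin\Bigl(\frac{2\pi ny}{l}\Bigr)dy.$$ Finally, the liquid–vapor interface is given by $$x(y,z)=m(z-R)+\eta u(y,z)=m(z-R)+\sum_{n=1}^\infty\Bigl[A_n\cos\Bigl(\pi n\frac{y+l_y}{l_y}\Bigr)+B_n\sin\Bigl(\pi n\frac{y+l_y}{l_y}\Bigr)\Bigr]\frac{1}{\sinh\bigl(\frac{2\pi nh}{l}\bigr)}\sinh\Bigl(\pi n\sqrt{1+m^2}\,\frac{R-z}{l_y}\Bigr).$$
   Context: The liquid–vapor interface away from a rough solid surface is assumed to be a graph $x=x(y,z)$ over $\{(y,z):y\in[-l_y,l_y],\ z\in[r,R]\}$, periodic in $y$, where $0<r\ll R$, $R\gg1$. Subscripts denote partial derivatives. The function $f(y)$ is the given trace of the interface at the lower height $z=r$, and $\|\cdot\|_\infty$ is the sup norm. The interface is assumed to differ only slightly from a plane, $\|x(y,z)-m(z-R)\|_{L^\infty}\le C\eta$ for some constant $C>0$, with $\eta$ a relatively small amplitude. The approximation at leading order is a formal asymptotic statement: it is obtained by inserting the expansion into the system and matching the $O(\eta)$ terms. *)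

theory Defs
  imports "HOL-Analysis.Analysis"
begin

definition rect :: "real \<Rightarrow> real \<Rightarrow> real \<Rightarrow> (real \<times> real) set" where
  "rect ly r R = {-ly..ly} \<times> {r..R}"

text \<open>The lateral sides \<open>y = -ly\<close> and \<open>y = ly\<close> belong to the strip: they are identified by the
  periodicity conditions and are no genuine boundary.\<close>
definition strip :: "real \<Rightarrow> real \<Rightarrow> real \<Rightarrow> (real \<times> real) set" where
  "strip ly r R = {-ly..ly} \<times> {r<..<R}"

text \<open>Partial derivatives of functions of \<open>(y,z)\<close>, one-sided on the sides of the rectangle, so that
  the values of a function outside the rectangle never matter.\<close>
definition Dy :: "real \<Rightarrow> (real \<Rightarrow> real \<Rightarrow> real) \<Rightarrow> real \<Rightarrow> real \<Rightarrow> real" where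
  "Dy ly w y z = vector_derivative (\<lambda>s. w s z) (at y within {-ly..ly})"

definition Dz :: "real \<Rightarrow> real \<Rightarrow> (real \<Rightarrow> real \<Rightarrow> real) \<Rightarrow> real \<Rightarrow> real \<Rightarrow> real" where
  "Dz r R w y z = vector_derivative (\<lambda>t. w y t) (at z within {r..R})"

text \<open>Regularity of a classical solution: continuous on the closed rectangle, twice continuously
  differentiable up to the lateral sides. The derivative in \<open>y\<close> also exists at \<open>z = r\<close> and \<open>z = R\<close>,
  because its periodicity is required there.\<close>
definition C2_strip :: "real \<Rightarrow> real \<Rightarrow> real \<Rightarrow> (real \<Rightarrow> real \<Rightarrow> real) \<Rightarrow> bool" where
  "C2_strip ly r R w \<longleftrightarrow>
     continuous_on (rect ly r R) (\<lambda>(y, z). w y z) \<and>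
     (\<forall>(y, z) \<in> rect ly r R. (\<lambda>s. w s z) differentiable (at y within {-ly..ly})) \<and>
     (\<forall>(y, z) \<in> strip ly r R.
        (\<lambda>t. w y t) differentiable (at z within {r..R}) \<and>
        (\<lambda>s. Dy ly w s z) differentiable (at y within {-ly..ly}) \<and>
        (\<lambda>t. Dy ly w y t) differentiable (at z within {r..R}) \<and>
        (\<lambda>s. Dz r R w s z) differentiable (at y within {-ly..ly}) \<and>
        (\<lambda>t. Dz r R w y t) differentiable (at z within {r..R})) \<and>
     continuous_on (strip ly r R) (\<lambda>(y, z). Dy ly w y z) \<and>
     continuous_on (strip ly r R) (\<lambda>(y, z). Dz r R w y z) \<and>
     continuous_on (strip ly r R) (\<lambda>(y, z). Dy ly (Dy ly w) y z) \<and>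
     continuous_on (strip ly r R) (\<lambda>(y, z). Dz r R (Dy ly w) y z) \<and>
     continuous_on (strip ly r R) (\<lambda>(y, z). Dy ly (Dz r R w) y z) \<and>
     continuous_on (strip ly r R) (\<lambda>(y, z). Dz r R (Dz r R w) y z)"

text \<open>Bound on all derivatives of order at most two, i.e. on the \<open>C\<^sup>2\<close> norm.\<close>
definition C2_bound :: "real \<Rightarrow> real \<Rightarrow> real \<Rightarrow> (real \<Rightarrow> real \<Rightarrow> real) \<Rightarrow> real \<Rightarrow> bool" where
  "C2_bound ly r R w c \<longleftrightarrow>
     (\<forall>(y, z) \<in> rect ly r R. \<bar>w y z\<bar> \<le> c \<and> \<bar>Dy ly w y z\<bar> \<le> c) \<and>
     (\<forall>(y, z) \<in> strip ly r R.
        \<bar>Dz r R w y z\<bar> \<le> c \<and> \<bar>Dy ly (Dy ly w) y z\<bar> \<le> c \<and> \<bar>Dz r R (Dy ly w) y z\<bar> \<le> c \<and>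
        \<bar>Dy ly (Dz r R w) y z\<bar> \<le> c \<and> \<bar>Dz r R (Dz r R w) y z\<bar> \<le> c)"

definition periodic_C1 :: "real \<Rightarrow> (real \<Rightarrow> real) \<Rightarrow> bool" where
  "periodic_C1 ly f \<longleftrightarrow>
     (\<exists>f'. (\<forall>y \<in> {-ly..ly}. (f has_real_derivative f' y) (at y within {-ly..ly})) \<and>
           continuous_on {-ly..ly} f' \<and> f (-ly) = f ly \<and> f' (-ly) = f' ly)"

definition slope :: "real \<Rightarrow> real \<Rightarrow> real \<Rightarrow> (real \<Rightarrow> real) \<Rightarrow> real" where
  "slope ly r R f = 1 / (r - R) * (1 / (2 * ly)) * integral {-ly..ly} f"

definition amplitude :: "real \<Rightarrow> real \<Rightarrow> real \<Rightarrow> (real \<Rightarrow> real) \<Rightarrow> real" where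
  "amplitude ly r R f = (SUP y \<in> {-ly..ly}. \<bar>f y - slope ly r R f * (r - R)\<bar>)"

definition minimal_op ::
  "real \<Rightarrow> real \<Rightarrow> real \<Rightarrow> (real \<Rightarrow> real \<Rightarrow> real) \<Rightarrow> real \<Rightarrow> real \<Rightarrow> real" where
  "minimal_op ly r R x y z =
     (1 + (Dy ly x y z)\<^sup>2) * Dz r R (Dz r R x) y z
     - 2 * Dy ly x y z * Dz r R x y z * Dz r R (Dy ly x) y z
     + (1 + (Dz r R x y z)\<^sup>2) * Dy ly (Dy ly x) y z"

definition linear_op ::
  "real \<Rightarrow> real \<Rightarrow> real \<Rightarrow> real \<Rightarrow> (real \<Rightarrow> real \<Rightarrow> real) \<Rightarrow> real \<Rightarrow> real \<Rightarrow> real" where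
  "linear_op ly r R m u y z = Dz r R (Dz r R u) y z + (1 + m\<^sup>2) * Dy ly (Dy ly u) y z"

definition minimal_system ::
  "real \<Rightarrow> real \<Rightarrow> real \<Rightarrow> (real \<Rightarrow> real) \<Rightarrow> (real \<Rightarrow> real \<Rightarrow> real) \<Rightarrow> bool" where
  "minimal_system ly r R f x \<longleftrightarrow>
     C2_strip ly r R x \<and>
     (\<forall>(y, z) \<in> strip ly r R. minimal_op ly r R x y z = 0) \<and>
     (\<forall>y \<in> {-ly..ly}. x y r = f y) \<and>
     (\<forall>y \<in> {-ly..ly}. x y R = 0) \<and>
     (\<forall>z \<in> {r..R}. x (-ly) z = x ly z) \<and>
     (\<forall>z \<in> {r..R}. Dy ly x (-ly) z = Dy ly x ly z)"

definition linear_system ::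
  "real \<Rightarrow> real \<Rightarrow> real \<Rightarrow> (real \<Rightarrow> real) \<Rightarrow> (real \<Rightarrow> real \<Rightarrow> real) \<Rightarrow> bool" where
  "linear_system ly r R f u \<longleftrightarrow>
     C2_strip ly r R u \<and>
     (\<forall>(y, z) \<in> strip ly r R. linear_op ly r R (slope ly r R f) u y z = 0) \<and>
     (\<forall>y \<in> {-ly..ly}. u y r = 1 / amplitude ly r R f * (f y - slope ly r R f * (r - R))) \<and>
     (\<forall>y \<in> {-ly..ly}. u y R = 0) \<and>
     (\<forall>z \<in> {r..R}. u (-ly) z = u ly z) \<and>
     (\<forall>z \<in> {r..R}. Dy ly u (-ly) z = Dy ly u ly z)"

definition period :: "real \<Rightarrow> real \<Rightarrow> real \<Rightarrow> (real \<Rightarrow> real) \<Rightarrow> real" where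
  "period ly r R f = 2 * ly / sqrt (1 + (slope ly r R f)\<^sup>2)"

definition rescaled_trace :: "real \<Rightarrow> real \<Rightarrow> real \<Rightarrow> (real \<Rightarrow> real) \<Rightarrow> real \<Rightarrow> real" where
  "rescaled_trace ly r R f y =
     f (sqrt (1 + (slope ly r R f)\<^sup>2) * y - ly) - slope ly r R f * (r - R)"

definition cos_coeff :: "real \<Rightarrow> real \<Rightarrow> real \<Rightarrow> (real \<Rightarrow> real) \<Rightarrow> nat \<Rightarrow> real" where
  "cos_coeff ly r R f n =
     (let l = period ly r R f
      in 2 / l * integral {0..l} (\<lambda>y. rescaled_trace ly r R f y * cos (2 * pi * real n * y / l)))"

definition sin_coeff :: "real \<Rightarrow> real \<Rightarrow> real \<Rightarrow> (real \<Rightarrow> real) \<Rightarrow> nat \<Rightarrow> real" where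
  "sin_coeff ly r R f n =
     (let l = period ly r R f
      in 2 / l * integral {0..l} (\<lambda>y. rescaled_trace ly r R f y * sin (2 * pi * real n * y / l)))"

definition fourier_mode ::
  "real \<Rightarrow> real \<Rightarrow> real \<Rightarrow> (real \<Rightarrow> real) \<Rightarrow> nat \<Rightarrow> real \<Rightarrow> real \<Rightarrow> real" where
  "fourier_mode ly r R f n y z =
     (cos_coeff ly r R f n * cos (pi * real n * ((y + ly) / ly))
      + sin_coeff ly r R f n * sin (pi * real n * ((y + ly) / ly)))
     * (1 / sinh (2 * pi * real n * (R - r) / period ly r R f))
     * sinh (pi * real n * sqrt (1 + (slope ly r R f)\<^sup>2) * ((R - z) / ly))"

text \<open>The index is shifted because the Fourier series starts at \<open>n = 1\<close>.\<close>
definition fourier_u :: "real \<Rightarrow> real \<Rightarrow> real \<Rightarrow> (real \<Rightarrow> real) \<Rightarrow> real \<Rightarrow> real \<Rightarrow> real" where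
  "fourier_u ly r R f y z =
     1 / amplitude ly r R f * (\<Sum>n. fourier_mode ly r R f (Suc n) y z)"

text \<open>\<open>h\<^sub>i(p) = o(a\<^sub>i)\<close> along the filter \<open>F\<close>, uniformly in \<open>p \<in> S\<close>; used for positive \<open>a\<^sub>i\<close> only.\<close>
definition unif_smallo :: "'i filter \<Rightarrow> ('i \<Rightarrow> real) \<Rightarrow> 'p set \<Rightarrow> ('i \<Rightarrow> 'p \<Rightarrow> real) \<Rightarrow> bool" where
  "unif_smallo F a S h \<longleftrightarrow> uniform_limit S (\<lambda>i p. h i p / a i) (\<lambda>_. 0) F"

text \<open>An asymptotic expansion in the amplitude needs a family of interfaces \<open>x\<^sub>i\<close> with traces \<open>f\<^sub>i\<close>
  whose amplitudes \<open>\<eta>\<^sub>i\<close> tend to zero: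
  \<open>x\<^sub>i(y,z) = m\<^sub>i (z - R) + \<eta>\<^sub>i u\<^sub>i(y,z) + o(\<eta>\<^sub>i)\<close>, where \<open>m\<^sub>i\<close> and \<open>u\<^sub>i\<close> are of order one. Since the
  expansion is inserted into a second order equation, the orders are measured in the \<open>C\<^sup>2\<close> norm.\<close>
definition interface_expansion ::
  "real \<Rightarrow> real \<Rightarrow> real \<Rightarrow> 'i filter \<Rightarrow> ('i \<Rightarrow> real \<Rightarrow> real) \<Rightarrow>
   ('i \<Rightarrow> real \<Rightarrow> real \<Rightarrow> real) \<Rightarrow> ('i \<Rightarrow> real \<Rightarrow> real \<Rightarrow> real) \<Rightarrow> bool" where
  "interface_expansion ly r R F f x u \<longleftrightarrow>
     (\<forall>\<^sub>F i in F. periodic_C1 ly (f i) \<and> 0 < amplitude ly r R (f i) \<and>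
                C2_strip ly r R (x i) \<and> C2_strip ly r R (u i)) \<and>
     ((\<lambda>i. amplitude ly r R (f i)) \<longlongrightarrow> 0) F \<and>
     (\<exists>M. \<forall>\<^sub>F i in F. \<bar>slope ly r R (f i)\<bar> \<le> M) \<and>
     (\<exists>K. \<forall>\<^sub>F i in F. C2_bound ly r R (u i) K) \<and>
     (\<forall>e>0. \<forall>\<^sub>F i in F.
        C2_bound ly r R
          (\<lambda>y z. x i y z - (slope ly r R (f i) * (z - R) + u i y z * amplitude ly r R (f i)))
          (e * amplitude ly r R (f i)))"

text \<open>Matching of the terms of order \<open>\<eta>\<close>: each equation of the minimal surface system, written as
  left-hand side minus right-hand side, equals \<open>\<eta>\<close> times the corresponding equation of the linear
  system, up to \<open>o(\<eta>)\<close>.\<close>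
definition leading_order_match ::
  "real \<Rightarrow> real \<Rightarrow> real \<Rightarrow> 'i filter \<Rightarrow> ('i \<Rightarrow> real \<Rightarrow> real) \<Rightarrow>
   ('i \<Rightarrow> real \<Rightarrow> real \<Rightarrow> real) \<Rightarrow> ('i \<Rightarrow> real \<Rightarrow> real \<Rightarrow> real) \<Rightarrow> bool" where
  "leading_order_match ly r R F f x u \<longleftrightarrow>
     (let m = (\<lambda>i. slope ly r R (f i)); \<eta> = (\<lambda>i. amplitude ly r R (f i)) in
      unif_smallo F \<eta> (strip ly r R)
        (\<lambda>i (y, z). minimal_op ly r R (x i) y z - \<eta> i * linear_op ly r R (m i) (u i) y z) \<and>
      unif_smallo F \<eta> {-ly..ly}
        (\<lambda>i y. (x i y r - f i y) - \<eta> i * (u i y r - 1 / \<eta> i * (f i y - m i * (r - R)))) \<and>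
      unif_smallo F \<eta> {-ly..ly} (\<lambda>i y. x i y R - \<eta> i * u i y R) \<and>
      unif_smallo F \<eta> {r..R}
        (\<lambda>i z. (x i (-ly) z - x i ly z) - \<eta> i * (u i (-ly) z - u i ly z)) \<and>
      unif_smallo F \<eta> {r..R}
        (\<lambda>i z. (Dy ly (x i) (-ly) z - Dy ly (x i) ly z)
               - \<eta> i * (Dy ly (u i) (-ly) z - Dy ly (u i) ly z)))"

end

theory Submission
  imports Defs
begin

text \<open>Put \<open>L w = w\<^sub>z\<^sub>z + (1 + m\<^sup>2) w\<^sub>y\<^sub>y\<close>. If \<open>x\<close> is \<open>O(\<eta>)\<close>-close to the plane \<open>m (z - R)\<close> in \<open>C\<^sup>2\<close>, the minimal
  surface operator differs from \<open>L x\<close> only by products of two \<open>O(\<eta>)\<close> factors, and \<open>L x = \<eta> L u + o(\<eta>)\<close>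
  because \<open>L\<close> kills the plane; this is the matching.

  The trace is periodic and \<open>C\<^sup>1\<close>, so Bessel's inequality for its derivative makes the Fourier
  coefficients absolutely summable, which gives continuity of the series up to \<open>z = r\<close>; for \<open>z > r\<close> the
  exponential decay of the quotients of \<open>sinh\<close> allows differentiation term by term.

  For a solution \<open>x\<close> of the minimal surface system the difference of \<open>x\<close> and the series vanishes exactly
  at \<open>z = r\<close> and \<open>z = R\<close> and is exactly periodic, while \<open>L\<close> of it is \<open>O(\<eta>\<^sup>2)\<close>; the maximum principle
  then bounds it by \<open>O(\<eta>\<^sup>2)\<close>.\<close>

section \<open>Fourier series of periodic functions\<close>

text \<open>The expansion does not assume that \<open>u\<close> solves the linear system, and
  \<open>u\<close> may change along the filter, so matching by itself only makes the residuals of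
  \<open>u\<close> tend to zero. They are forced to vanish if slope, profile and normalized trace
  stay fixed, because a residual is then a constant that is \<open>o(1)\<close>. For the same reason
  the asymptotics compare \<open>x\<close> directly with the series; \<open>u\<close> enters there
  only through the \<open>C^2\<close> bounds of the expansion, which make the nonlinear remainder
  quadratic.

  The trace is only \<open>C^1\<close>, and this shapes the treatment of the lower height
  \<open>z = r\<close>. The differentiated series need not converge there, so the
  \<open>y\<close>-derivative is read off from the boundary value, and that boundary value needs a
  convergence proof for Fourier series that includes the end points of the period. Second
  derivatives are claimed for \<open>r < z < R\<close> only; together with continuity on the closed
  rectangle this suffices for the maximum principle.\<close>

lemma has_integral_cos_period:
  fixes l c :: real and k :: int
  assumes l: "0 < l" and k: "k \<noteq> 0"
  shows "((\<lambda>t. cos (2 * pi * k * t / l + c)) has_integral 0) {0..l}"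
proof -
  define w where "w = 2 * pi * k / l"
  have w: "w \<noteq> 0" "w * l = 2 * pi * k" using l k by (auto simp: w_def)
  have "((\<lambda>t. cos (w * t + c)) has_integral (sin (w * l + c) / w - sin (w * 0 + c) / w)) {0..l}"
    using l w by (intro fundamental_theorem_of_calculus)
      (auto simp: has_real_derivative_iff_has_vector_derivative[symmetric] intro!: derivative_eq_intros)
  moreover have "sin (w * l + c) = sin c"
    unfolding w by (simp add: sin_add sin_int_2pin cos_int_2pin)
  ultimately show ?thesis by (simp add: w_def mult_ac)
qed

text \<open>The integral of the square of \<open>h\<close> minus its projection onto the first
  \<open>N\<close> functions is nonnegative; expanding it bounds every partial sum by
  \<open>c\<close> times the integral of the square of \<open>h\<close>. Completeness of the system
  is not involved.\<close>

lemma bessel_inequality: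
  fixes e :: "nat \<Rightarrow> real \<Rightarrow> real" and h :: "real \<Rightarrow> real"
  assumes c: "0 < c" and h: "continuous_on {a..b} h" and e: "\<And>n. continuous_on {a..b} (e n)"
    and orth: "\<And>m n. ((\<lambda>t. e m t * e n t) has_integral (if m = n then c else 0)) {a..b}"
  shows "summable (\<lambda>n. (integral {a..b} (\<lambda>t. h t * e n t))\<^sup>2)"
proof (rule summableI_nonneg_bounded)
  fix N :: nat
  define \<alpha> where "\<alpha> = (\<lambda>n. integral {a..b} (\<lambda>t. h t * e n t) / c)"
  have he: "((\<lambda>t. h t * e n t) has_integral c * \<alpha> n) {a..b}" for n
    using c by (auto simp: \<alpha>_def intro!: integrable_integral integrable_continuous_interval continuous_intros h e)
  have hh: "((\<lambda>t. (h t)\<^sup>2) has_integral integral {a..b} (\<lambda>t. (h t)\<^sup>2)) {a..b}"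
    by (auto intro!: integrable_integral integrable_continuous_interval continuous_intros h)
  have "((\<lambda>t. (h t)\<^sup>2 - 2 * (\<Sum>n<N. \<alpha> n * (h t * e n t))
          + (\<Sum>m<N. \<Sum>n<N. \<alpha> m * \<alpha> n * (e m t * e n t)))
        has_integral (integral {a..b} (\<lambda>t. (h t)\<^sup>2) - 2 * (\<Sum>n<N. \<alpha> n * (c * \<alpha> n))
          + (\<Sum>m<N. \<Sum>n<N. \<alpha> m * \<alpha> n * (if m = n then c else 0)))) {a..b}"
    by (intro has_integral_add has_integral_diff has_integral_mult_right has_integral_sum hh he orth) auto
  moreover have "(h t)\<^sup>2 - 2 * (\<Sum>n<N. \<alpha> n * (h t * e n t))
          + (\<Sum>m<N. \<Sum>n<N. \<alpha> m * \<alpha> n * (e m t * e n t)) = (h t - (\<Sum>n<N. \<alpha> n * e n t))\<^sup>2" for t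
  proof -
    have "h t * (\<Sum>n<N. \<alpha> n * e n t) = (\<Sum>n<N. \<alpha> n * (h t * e n t))"
      by (simp add: sum_distrib_left mult_ac)
    moreover have "(\<Sum>n<N. \<alpha> n * e n t)\<^sup>2 = (\<Sum>m<N. \<Sum>n<N. \<alpha> m * \<alpha> n * (e m t * e n t))"
      by (simp add: power2_eq_square sum_product mult_ac)
    ultimately show ?thesis by (simp add: power2_diff)
  qed
  ultimately have "0 \<le> integral {a..b} (\<lambda>t. (h t)\<^sup>2) - 2 * (\<Sum>n<N. \<alpha> n * (c * \<alpha> n))
          + (\<Sum>m<N. \<Sum>n<N. \<alpha> m * \<alpha> n * (if m = n then c else 0))"
    by (metis (no_types, lifting) has_integral_nonneg zero_le_power2)
  also have "\<dots> = integral {a..b} (\<lambda>t. (h t)\<^sup>2) - (\<Sum>n<N. c * (\<alpha> n)\<^sup>2)"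
  proof -
    have "\<alpha> m * \<alpha> n * (if m = n then c else 0) = (if m = n then c * (\<alpha> m)\<^sup>2 else 0)" for m n
      by (simp add: power2_eq_square)
    then show ?thesis by (simp add: power2_eq_square mult_ac)
  qed
  finally have "(\<Sum>n<N. c * (\<alpha> n)\<^sup>2) \<le> integral {a..b} (\<lambda>t. (h t)\<^sup>2)" by simp
  then have "c * (\<Sum>n<N. c * (\<alpha> n)\<^sup>2) \<le> c * integral {a..b} (\<lambda>t. (h t)\<^sup>2)"
    using c by simp
  moreover have "c * (\<Sum>n<N. c * (\<alpha> n)\<^sup>2) = (\<Sum>n<N. (integral {a..b} (\<lambda>t. h t * e n t))\<^sup>2)"
    using c by (simp add: \<alpha>_def sum_distrib_left power2_eq_square)
  ultimately show "(\<Sum>n<N. (integral {a..b} (\<lambda>t. h t * e n t))\<^sup>2) \<le> c * integral {a..b} (\<lambda>t. (h t)\<^sup>2)"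
    by simp
qed simp

text \<open>This is the product-to-sum form of two trigonometric factors: \<open>k\<close> is the
  difference and \<open>j\<close> the sum of their frequencies, and \<open>d\<close> is -1 for sines
  and 1 for cosines. The sum never vanishes, so only a zero difference leaves a
  contribution.\<close>

lemma has_integral_trig_product:
  fixes l c d :: real and j k :: int
  assumes "0 < l" "j \<noteq> 0"
  shows "((\<lambda>t. (cos (2 * pi * k * t / l + c) + d * cos (2 * pi * j * t / l + c')) / 2)
     has_integral (if k = 0 then l * cos c / 2 else 0)) {0..l}"
proof -
  have "((\<lambda>t. cos (2 * pi * k * t / l + c)) has_integral (if k = 0 then l * cos c else 0)) {0..l}"
    using has_integral_cos_period[OF assms(1), of k c] has_integral_const_real[of "cos c" 0 l] assms(1)
    by auto
  from has_integral_divide[where c = 2, OF has_integral_add[OF this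
      has_integral_mult_right[where c = d, OF has_integral_cos_period[OF assms, of c']]]]
  show ?thesis by (auto split: if_splits)
qed

text \<open>The frequencies \<open>p n\<close> are the integers \<open>n + 1\<close> or the half-integers \<open>n + 1/2\<close>; the latter are the
  numerators of the Dirichlet kernels, so that Bessel's inequality alone yields pointwise convergence.\<close>
lemma trig_orthogonal:
  fixes l c :: real
  assumes l: "0 < l" and p: "\<And>m n :: nat. p m + p n = real_of_int (s m n) \<and> s m n \<noteq> 0"
    and d: "\<And>m n. p m - p n = real_of_int (int m - int n)"
  shows "((\<lambda>t. sin (2 * pi * p m * (t - x) / l) * sin (2 * pi * p n * (t - x) / l))
     has_integral (if m = n then l / 2 else 0)) {0..l}"
    and "((\<lambda>t. cos (2 * pi * p m * (t - x) / l) * cos (2 * pi * p n * (t - x) / l))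
     has_integral (if m = n then l / 2 else 0)) {0..l}"
proof -
  let ?A = "\<lambda>t. cos (2 * pi * (int m - int n) * t / l + (- 2 * pi * (int m - int n) * x / l))"
  let ?B = "\<lambda>t. cos (2 * pi * s m n * t / l + (- 2 * pi * s m n * x / l))"
  have A: "?A t = cos (2 * pi * p m * (t - x) / l - 2 * pi * p n * (t - x) / l)" for t
    using l unfolding d[symmetric] by (intro arg_cong[where f = cos]) (simp add: field_simps)
  have B: "?B t = cos (2 * pi * p m * (t - x) / l + 2 * pi * p n * (t - x) / l)" for t
    using l p[of m n, THEN conjunct1, symmetric] by (intro arg_cong[where f = cos]) (simp add: field_simps)
  have *: "((\<lambda>t. (?A t + \<delta> * ?B t) / 2) has_integral (if m = n then l / 2 else 0)) {0..l}" for \<delta>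
    using has_integral_trig_product[OF l, of "s m n" "int m - int n" "- 2 * pi * (int m - int n) * x / l" \<delta>
       "- 2 * pi * s m n * x / l"] p[of m n]
    by (auto split: if_splits)
  show "((\<lambda>t. sin (2 * pi * p m * (t - x) / l) * sin (2 * pi * p n * (t - x) / l))
     has_integral (if m = n then l / 2 else 0)) {0..l}"
    using *[of "-1"] unfolding A B by (simp add: sin_times_sin)
  show "((\<lambda>t. cos (2 * pi * p m * (t - x) / l) * cos (2 * pi * p n * (t - x) / l))
     has_integral (if m = n then l / 2 else 0)) {0..l}"
    using *[of 1] unfolding A B by (simp add: cos_times_cos)
qed

section \<open>Fourier coefficients and the Dirichlet kernel\<close>

lemma summable_sin_cos_coeff_squares:
  fixes h :: "real \<Rightarrow> real"
  assumes l: "0 < l" and h: "continuous_on {0..l} h"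
  shows "summable (\<lambda>n. (integral {0..l} (\<lambda>t. h t * sin (2 * pi * real (Suc n) * t / l)))\<^sup>2)"
    and "summable (\<lambda>n. (integral {0..l} (\<lambda>t. h t * cos (2 * pi * real (Suc n) * t / l)))\<^sup>2)"
    and "summable (\<lambda>n. (integral {0..l} (\<lambda>t. h t * sin (2 * pi * (real n + 1/2) * (t - x) / l)))\<^sup>2)"
proof -
  note o1 = trig_orthogonal[where p = "\<lambda>n. real (Suc n)" and s = "\<lambda>m n. int (m + n + 2)" and x = 0, OF l]
  note o2 = trig_orthogonal[where p = "\<lambda>n. real n + 1/2" and s = "\<lambda>m n. int (m + n + 1)" and x = x, OF l]
  show "summable (\<lambda>n. (integral {0..l} (\<lambda>t. h t * sin (2 * pi * real (Suc n) * t / l)))\<^sup>2)"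
    by (rule bessel_inequality[where c = "l / 2"])
       (use l h o1(1) in \<open>auto intro!: continuous_intros\<close>)
  show "summable (\<lambda>n. (integral {0..l} (\<lambda>t. h t * cos (2 * pi * real (Suc n) * t / l)))\<^sup>2)"
    by (rule bessel_inequality[where c = "l / 2"])
       (use l h o1(2) in \<open>auto intro!: continuous_intros\<close>)
  show "summable (\<lambda>n. (integral {0..l} (\<lambda>t. h t * sin (2 * pi * (real n + 1/2) * (t - x) / l)))\<^sup>2)"
    by (rule bessel_inequality[where c = "l / 2"])
       (use l h o2(1) in \<open>auto intro!: continuous_intros\<close>)
qed

text \<open>Each new cosine, multiplied by \<open>2 * sin (\<theta> / 2)\<close>, is a difference of
  consecutive half-integer sines, so the sum telescopes. The form without division stays valid where
  the sine vanishes.\<close>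

lemma dirichlet_kernel:
  fixes \<theta> :: real
  shows "2 * sin (\<theta> / 2) * (1 / 2 + (\<Sum>n<N. cos (real (Suc n) * \<theta>))) = sin ((real N + 1 / 2) * \<theta>)"
proof (induction N)
  case (Suc N)
  have "sin ((real (Suc N) + 1 / 2) * \<theta>) - sin ((real N + 1 / 2) * \<theta>)
      = 2 * sin (\<theta> / 2) * cos (real (Suc N) * \<theta>)"
  proof -
    have "((real (Suc N) + 1 / 2) * \<theta> + (real N + 1 / 2) * \<theta>) / 2 = real (Suc N) * \<theta>"
      and "((real (Suc N) + 1 / 2) * \<theta> - (real N + 1 / 2) * \<theta>) / 2 = \<theta> / 2"
      by (simp_all add: field_simps)
    then show ?thesis by (simp only: sin_diff_sin)
  qed
  with Suc show ?case by (simp add: algebra_simps)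
qed simp

text \<open>Integration by parts over a full period. Against the sine the boundary term vanishes by
  itself; against the cosine it is \<open>\<phi> l - \<phi> 0\<close>, and periodicity removes
  it.\<close>

lemma fourier_coeff_by_parts:
  fixes \<phi> \<phi>' :: "real \<Rightarrow> real"
  assumes l: "0 < l"
    and der: "\<And>t. t \<in> {0..l} \<Longrightarrow> (\<phi> has_real_derivative \<phi>' t) (at t within {0..l})"
    and \<phi>': "continuous_on {0..l} \<phi>'" and per: "\<phi> 0 = \<phi> l"
  shows "integral {0..l} (\<lambda>t. \<phi>' t * sin (2 * pi * real n * t / l))
       = - (2 * pi * real n / l) * integral {0..l} (\<lambda>t. \<phi> t * cos (2 * pi * real n * t / l))"
    and "integral {0..l} (\<lambda>t. \<phi>' t * cos (2 * pi * real n * t / l))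
       = (2 * pi * real n / l) * integral {0..l} (\<lambda>t. \<phi> t * sin (2 * pi * real n * t / l))"
proof -
  have \<phi>: "continuous_on {0..l} \<phi>"
    using der by (meson DERIV_continuous_on)
  define w where "w = 2 * pi * real n / l"
  have wl: "w * l = 2 * pi * real n" using l by (simp add: w_def)
  have sl: "sin (w * l) = 0" "cos (w * l) = 1"
    unfolding wl using sin_int_2pin[of "int n"] cos_int_2pin[of "int n"] by simp_all
  have ints: "((\<lambda>t. h t * sin (w * t)) has_integral integral {0..l} (\<lambda>t. h t * sin (w * t))) {0..l}"
    "((\<lambda>t. h t * cos (w * t)) has_integral integral {0..l} (\<lambda>t. h t * cos (w * t))) {0..l}"
    if "continuous_on {0..l} h" for h
    by (auto intro!: integrable_integral integrable_continuous_interval continuous_intros that)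
  have "((\<lambda>t. \<phi>' t * sin (w * t) + w * (\<phi> t * cos (w * t))) has_integral
      \<phi> l * sin (w * l) - \<phi> 0 * sin (w * 0)) {0..l}"
    using l by (intro fundamental_theorem_of_calculus)
      (auto simp: has_real_derivative_iff_has_vector_derivative[symmetric]
        intro!: derivative_eq_intros der)
  from has_integral_unique[OF this has_integral_add[OF ints(1)[OF \<phi>'] has_integral_mult_right[OF ints(2)[OF \<phi>]]]]
  show "integral {0..l} (\<lambda>t. \<phi>' t * sin (2 * pi * real n * t / l))
       = - (2 * pi * real n / l) * integral {0..l} (\<lambda>t. \<phi> t * cos (2 * pi * real n * t / l))"
    using sl by (simp add: w_def)
  have "((\<lambda>t. \<phi>' t * cos (w * t) + - w * (\<phi> t * sin (w * t))) has_integral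
      \<phi> l * cos (w * l) - \<phi> 0 * cos (w * 0)) {0..l}"
    using l by (intro fundamental_theorem_of_calculus)
      (auto simp: has_real_derivative_iff_has_vector_derivative[symmetric]
        intro!: derivative_eq_intros der)
  from has_integral_unique[OF this has_integral_add[OF ints(2)[OF \<phi>'] has_integral_mult_right[OF ints(1)[OF \<phi>]]]]
  show "integral {0..l} (\<lambda>t. \<phi>' t * cos (2 * pi * real n * t / l))
       = (2 * pi * real n / l) * integral {0..l} (\<lambda>t. \<phi> t * sin (2 * pi * real n * t / l))"
    using sl per by (simp add: w_def)
qed

text \<open>Each \<open>\<bar>c n\<bar>\<close> is the product of \<open>\<bar>d n\<bar>\<close> and
  \<open>1 / (w * real (Suc n))\<close>, hence at most the sum of their squares, and both families
  of squares are summable. With \<open>d\<close> the coefficients of the derivative, this gains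
  absolute summability from one derivative.\<close>

lemma summable_abs_of_weighted_squares:
  fixes c d :: "nat \<Rightarrow> real"
  assumes w: "0 < w" and d: "summable (\<lambda>n. (d n)\<^sup>2)"
    and eq: "\<And>n. \<bar>d n\<bar> = w * real (Suc n) * \<bar>c n\<bar>"
  shows "summable (\<lambda>n. \<bar>c n\<bar>)"
proof (rule summable_comparison_test')
  show "summable (\<lambda>n. (d n)\<^sup>2 + (1 / w)\<^sup>2 * (1 / (real (Suc n))\<^sup>2))"
    using inverse_squares_sums d
    by (intro summable_add summable_mult) (auto simp: sums_iff add.commute)
  fix n :: nat
  have "\<bar>c n\<bar> = \<bar>d n\<bar> * (1 / (w * real (Suc n)))"
    using w by (simp add: eq)
  also have "\<dots> \<le> (\<bar>d n\<bar>)\<^sup>2 + (1 / (w * real (Suc n)))\<^sup>2"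
  proof -
    have "0 \<le> \<bar>d n\<bar> * (1 / (w * real (Suc n)))" using w by simp
    then show ?thesis
      using sum_squares_bound[of "\<bar>d n\<bar>" "1 / (w * real (Suc n))"] by linarith
  qed
  finally show "norm \<bar>c n\<bar> \<le> (d n)\<^sup>2 + (1 / w)\<^sup>2 * (1 / (real (Suc n))\<^sup>2)"
    by (simp add: power_divide power_mult_distrib)
qed

lemma summable_fourier_coeff:
  fixes \<phi> \<phi>' :: "real \<Rightarrow> real"
  assumes l: "0 < l"
    and der: "\<And>t. t \<in> {0..l} \<Longrightarrow> (\<phi> has_real_derivative \<phi>' t) (at t within {0..l})"
    and \<phi>': "continuous_on {0..l} \<phi>'" and per: "\<phi> 0 = \<phi> l"
  shows "summable (\<lambda>n. \<bar>integral {0..l} (\<lambda>t. \<phi> t * cos (2 * pi * real (Suc n) * t / l))\<bar>)"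
    and "summable (\<lambda>n. \<bar>integral {0..l} (\<lambda>t. \<phi> t * sin (2 * pi * real (Suc n) * t / l))\<bar>)"
proof -
  note parts = fourier_coeff_by_parts[OF l der \<phi>' per]
  have w: "0 < 2 * pi / l" using l by simp
  have abs_factor: "\<bar>2 * pi * real (Suc n) / l\<bar> = 2 * pi / l * real (Suc n)" for n
    using l by simp
  show "summable (\<lambda>n. \<bar>integral {0..l} (\<lambda>t. \<phi> t * cos (2 * pi * real (Suc n) * t / l))\<bar>)"
    by (rule summable_abs_of_weighted_squares[OF w summable_sin_cos_coeff_squares(1)[OF l \<phi>']],
        simp only: parts(1) abs_mult abs_minus_cancel abs_factor)
  show "summable (\<lambda>n. \<bar>integral {0..l} (\<lambda>t. \<phi> t * sin (2 * pi * real (Suc n) * t / l))\<bar>)"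
    by (rule summable_abs_of_weighted_squares[OF w summable_sin_cos_coeff_squares(2)[OF l \<phi>']],
        simp only: parts(2) abs_mult abs_minus_cancel abs_factor)
qed

section \<open>Pointwise convergence of Fourier series\<close>

lemma sin_phase_nonzero:
  fixes l x t :: real
  assumes "0 < l" "x \<in> {0<..<l}" "t \<in> {0..l}" "t \<noteq> x"
  shows "sin (pi * (t - x) / l) \<noteq> 0"
proof -
  \<comment> \<open>Here \<open>x\<close> has to be an interior point: for \<open>x\<close> at an
    end of the period the phase would reach pi or -pi at the other end, where the sine vanishes
    again. Hence the end points are treated separately below.\<close>
  have "\<bar>(t - x) / l\<bar> < 1" using assms by (auto simp: field_simps)
  then have "pi * \<bar>(t - x) / l\<bar> < pi * 1"
    by (rule mult_strict_left_mono) simp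
  then have "\<bar>pi * (t - x) / l\<bar> < pi" by (simp add: abs_mult)
  moreover have "pi * (t - x) / l \<noteq> 0" using assms by simp
  ultimately show ?thesis using sin_eq_0_pi[of "pi * (t - x) / l"] by linarith
qed

text \<open>The exceptional value is the limit at \<open>x\<close>: the difference quotients of
  numerator and sine tend to \<open>D\<close> and \<open>pi / l\<close>, and
  \<open>D / (2 * (pi / l))\<close> is \<open>D * l / (2 * pi)\<close>. Differentiability at this
  one point makes the quotient continuous, so that Bessel's inequality applies to it.\<close>

lemma continuous_on_dirichlet_quotient:
  fixes \<phi> \<phi>' :: "real \<Rightarrow> real"
  assumes l: "0 < l" and x: "x \<in> {0<..<l}" and \<phi>: "continuous_on {0..l} \<phi>"
    and der: "(\<phi> has_real_derivative D) (at x within {0..l})"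
  shows "continuous_on {0..l} (\<lambda>t. if t = x then D * l / (2 * pi) else (\<phi> t - \<phi> x) / (2 * sin (pi * (t - x) / l)))"
    (is "continuous_on _ ?q")
  unfolding continuous_on_eq_continuous_within
proof
  fix t assume t: "t \<in> {0..l}"
  let ?g = "\<lambda>t. (\<phi> t - \<phi> x) / (2 * sin (pi * (t - x) / l))"
  show "continuous (at t within {0..l}) ?q"
  proof (cases "t = x")
    case False
    have "sin (pi * (t - x) / l) \<noteq> 0"
      by (rule sin_phase_nonzero[OF l x t False])
    then have "continuous (at t within {0..l}) ?g"
      using \<phi> t by (intro continuous_intros) (auto simp: continuous_on_eq_continuous_within)
    then show ?thesis
      using False t by (elim continuous_transform_within[where \<delta> = "dist t x"]) (auto simp: dist_commute)
  next
    case True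
    have "((\<lambda>t. sin (pi * (t - x) / l)) has_real_derivative pi / l) (at x within {0..l})"
      using l by (auto intro!: derivative_eq_intros)
    then have "((\<lambda>t. sin (pi * (t - x) / l) / (t - x)) \<longlongrightarrow> pi / l) (at x within {0..l})"
      by (simp add: has_field_derivative_iff)
    moreover have "((\<lambda>t. (\<phi> t - \<phi> x) / (t - x)) \<longlongrightarrow> D) (at x within {0..l})"
      using der by (simp add: has_field_derivative_iff)
    ultimately have "((\<lambda>t. ((\<phi> t - \<phi> x) / (t - x)) / (2 * (sin (pi * (t - x) / l) / (t - x))))
        \<longlongrightarrow> D / (2 * (pi / l))) (at x within {0..l})"
      using l by (intro tendsto_divide[OF _ tendsto_mult[OF tendsto_const]]) auto
    then have "(?q \<longlongrightarrow> D / (2 * (pi / l))) (at x within {0..l})"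
      by (rule Lim_transform_eventually) (auto simp: eventually_at_filter)
    then show ?thesis using True by (simp add: continuous_within)
  qed
qed

text \<open>The error of the \<open>N\<close>-th partial sum is, up to the factor
  \<open>2 / l\<close>, the \<open>N\<close>-th half-integer sine coefficient of the Dirichlet
  quotient. Its squares are summable, so it tends to zero. The mean is subtracted in the limit
  because the series has no constant term.\<close>

lemma fourier_sums_interior:
  fixes \<phi> \<phi>' :: "real \<Rightarrow> real"
  assumes l: "0 < l" and x: "x \<in> {0<..<l}" and \<phi>: "continuous_on {0..l} \<phi>"
    and der: "(\<phi> has_real_derivative D) (at x within {0..l})"
  shows "(\<lambda>n. 2 / l * (integral {0..l} (\<lambda>t. \<phi> t * cos (2 * pi * real (Suc n) * t / l)) * cos (2 * pi * real (Suc n) * x / l)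
             + integral {0..l} (\<lambda>t. \<phi> t * sin (2 * pi * real (Suc n) * t / l)) * sin (2 * pi * real (Suc n) * x / l)))
     sums (\<phi> x - integral {0..l} \<phi> / l)"
proof -
  let ?q = "\<lambda>t. if t = x then D * l / (2 * pi) else (\<phi> t - \<phi> x) / (2 * sin (pi * (t - x) / l))"
  let ?e = "\<lambda>N t. sin (2 * pi * (real N + 1 / 2) * (t - x) / l)"
  let ?c = "\<lambda>n t. cos (2 * pi * real (Suc n) * (t - x) / l)"
  have q: "continuous_on {0..l} ?q"
    by (rule continuous_on_dirichlet_quotient[OF assms])
  have q0: "(\<lambda>N. integral {0..l} (\<lambda>t. ?q t * ?e N t)) \<longlonglongrightarrow> 0"
    using summable_LIMSEQ_zero[OF summable_sin_cos_coeff_squares(3)[OF l q]] by simp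
  have partial: "(\<Sum>n<N. 2 / l * (integral {0..l} (\<lambda>t. \<phi> t * cos (2 * pi * real (Suc n) * t / l)) * cos (2 * pi * real (Suc n) * x / l)
             + integral {0..l} (\<lambda>t. \<phi> t * sin (2 * pi * real (Suc n) * t / l)) * sin (2 * pi * real (Suc n) * x / l)))
      = \<phi> x - integral {0..l} \<phi> / l + 2 / l * integral {0..l} (\<lambda>t. ?q t * ?e N t)" for N
  proof -
    let ?a = "\<lambda>n. integral {0..l} (\<lambda>t. \<phi> t * cos (2 * pi * real (Suc n) * t / l))"
    let ?b = "\<lambda>n. integral {0..l} (\<lambda>t. \<phi> t * sin (2 * pi * real (Suc n) * t / l))"
    let ?s = "\<lambda>n. ?a n * cos (2 * pi * real (Suc n) * x / l) + ?b n * sin (2 * pi * real (Suc n) * x / l)"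
    have ia: "((\<lambda>t. \<phi> t * cos (2 * pi * real (Suc n) * t / l)) has_integral ?a n) {0..l}"
      and ib: "((\<lambda>t. \<phi> t * sin (2 * pi * real (Suc n) * t / l)) has_integral ?b n) {0..l}"
      and ip: "(\<phi> has_integral integral {0..l} \<phi>) {0..l}" for n
      using l by (auto intro!: integrable_integral integrable_continuous_interval continuous_intros \<phi>)
    have ic: "((\<lambda>t. \<phi> t * ?c n t) has_integral ?s n) {0..l}" for n
    proof -
      have eq: "\<phi> t * ?c n t = \<phi> t * cos (2 * pi * real (Suc n) * t / l) * cos (2 * pi * real (Suc n) * x / l)
          + \<phi> t * sin (2 * pi * real (Suc n) * t / l) * sin (2 * pi * real (Suc n) * x / l)" for t
      proof -
        have "?c n t = cos (2 * pi * real (Suc n) * t / l - 2 * pi * real (Suc n) * x / l)"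
          by (simp only: right_diff_distrib diff_divide_distrib)
        then show ?thesis by (simp only: cos_diff distrib_left mult.assoc)
      qed
      show ?thesis
        unfolding eq by (intro has_integral_add has_integral_mult_left ia ib)
    qed
    have icx: "((\<lambda>t. \<phi> x * ?c n t) has_integral 0) {0..l}" for n
    proof -
      have eq: "?c n t = cos (2 * pi * int (Suc n) * t / l + (- 2 * pi * real (Suc n) * x / l))" for t
        by (simp add: right_diff_distrib diff_divide_distrib)
      show ?thesis
        unfolding eq using has_integral_mult_right[where c = "\<phi> x",
            OF has_integral_cos_period[OF l, of "int (Suc n)" "- 2 * pi * real (Suc n) * x / l"]]
        by simp
    qed
    \<comment> \<open>The integrand is \<open>\<phi> t - \<phi> x\<close> times the Dirichlet
      kernel. Since every cosine has mean zero, subtracting \<open>\<phi> x\<close> affects only the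
      integral of the constant term 1/2 of the kernel.\<close>
    have "((\<lambda>t. (\<phi> t - \<phi> x) * (1 / 2) + (\<Sum>n<N. \<phi> t * ?c n t - \<phi> x * ?c n t)) has_integral
        ((integral {0..l} \<phi> - \<phi> x * l) * (1 / 2) + (\<Sum>n<N. ?s n - 0))) {0..l}"
      using l has_integral_const_real[of "\<phi> x" 0 l]
      by (intro has_integral_add has_integral_mult_left has_integral_diff has_integral_sum ip ic icx)
         (auto simp: mult.commute)
    moreover have "(\<phi> t - \<phi> x) * (1 / 2) + (\<Sum>n<N. \<phi> t * ?c n t - \<phi> x * ?c n t) = ?q t * ?e N t"
      if "t \<in> {0..l}" for t
    proof (cases "t = x")
      case False
      have nz: "sin (pi * (t - x) / l) \<noteq> 0"
        by (rule sin_phase_nonzero[OF l x that False])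
      have e: "?e N t = 2 * sin (pi * (t - x) / l) * (1 / 2 + (\<Sum>n<N. ?c n t))"
      proof -
        have "2 * pi * (t - x) / l / 2 = pi * (t - x) / l"
          and "real (Suc n) * (2 * pi * (t - x) / l) = 2 * pi * real (Suc n) * (t - x) / l"
          and "(real N + 1 / 2) * (2 * pi * (t - x) / l) = 2 * pi * (real N + 1 / 2) * (t - x) / l" for n
          by simp_all
        then show ?thesis
          using dirichlet_kernel[of "2 * pi * (t - x) / l" N] by (simp only:)
      qed
      have "(\<phi> t - \<phi> x) * (1 / 2) + (\<Sum>n<N. \<phi> t * ?c n t - \<phi> x * ?c n t)
          = (\<phi> t - \<phi> x) * (1 / 2 + (\<Sum>n<N. ?c n t))"
        by (simp only: left_diff_distrib[symmetric] sum_distrib_left[symmetric] distrib_left)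
      then show ?thesis using False nz unfolding e by simp
    qed simp
    ultimately have "((\<lambda>t. ?q t * ?e N t) has_integral
        ((integral {0..l} \<phi> - \<phi> x * l) * (1 / 2) + (\<Sum>n<N. ?s n - 0))) {0..l}"
      by (rule has_integral_eq[rotated])
    note int = integral_unique[OF this]
    have alg: "2 / l * S = p - I / l + 2 / l * ((I - p * l) * (1 / 2) + S)" for S I p :: real
      using l by (simp add: field_simps)
    show ?thesis
      unfolding int diff_0_right sum_distrib_left[symmetric] by (rule alg)
  qed
  show ?thesis
    unfolding sums_def partial
    using tendsto_add[OF tendsto_const tendsto_mult_right_zero[OF q0, of "2 / l"]]
    by (simp only: add_0_right)
qed

text \<open>The end points of the period are reached by continuity: absolute summability of the
  coefficients makes the sum continuous, and its difference from \<open>\<phi>\<close>, constant on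
  the open interval, is constant on the closure.\<close>

lemma fourier_sums:
  fixes \<phi> \<phi>' :: "real \<Rightarrow> real"
  assumes l: "0 < l" and x: "x \<in> {0..l}"
    and der: "\<And>t. t \<in> {0..l} \<Longrightarrow> (\<phi> has_real_derivative \<phi>' t) (at t within {0..l})"
    and \<phi>': "continuous_on {0..l} \<phi>'" and per: "\<phi> 0 = \<phi> l"
  shows "(\<lambda>n. 2 / l * (integral {0..l} (\<lambda>t. \<phi> t * cos (2 * pi * real (Suc n) * t / l)) * cos (2 * pi * real (Suc n) * x / l)
             + integral {0..l} (\<lambda>t. \<phi> t * sin (2 * pi * real (Suc n) * t / l)) * sin (2 * pi * real (Suc n) * x / l)))
     sums (\<phi> x - integral {0..l} \<phi> / l)" (is "(\<lambda>n. ?s n x) sums _")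
proof -
  let ?a = "\<lambda>n. integral {0..l} (\<lambda>t. \<phi> t * cos (2 * pi * real (Suc n) * t / l))"
  let ?b = "\<lambda>n. integral {0..l} (\<lambda>t. \<phi> t * sin (2 * pi * real (Suc n) * t / l))"
  have \<phi>: "continuous_on {0..l} \<phi>"
    using der by (meson DERIV_continuous_on)
  have M: "summable (\<lambda>n. 2 / l * (\<bar>?a n\<bar> + \<bar>?b n\<bar>))"
    by (intro summable_mult summable_add summable_fourier_coeff[OF l der \<phi>' per])
  have bound: "norm (?s n y) \<le> 2 / l * (\<bar>?a n\<bar> + \<bar>?b n\<bar>)" for n y
  proof -
    have "\<bar>?a n * cos (2 * pi * real (Suc n) * y / l) + ?b n * sin (2 * pi * real (Suc n) * y / l)\<bar>
       \<le> \<bar>?a n\<bar> * \<bar>cos (2 * pi * real (Suc n) * y / l)\<bar> + \<bar>?b n\<bar> * \<bar>sin (2 * pi * real (Suc n) * y / l)\<bar>"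
      unfolding abs_mult[symmetric] by (rule abs_triangle_ineq)
    also have "\<dots> \<le> \<bar>?a n\<bar> * 1 + \<bar>?b n\<bar> * 1"
      by (intro add_mono mult_left_mono) auto
    finally have "\<bar>?a n * cos (2 * pi * real (Suc n) * y / l) + ?b n * sin (2 * pi * real (Suc n) * y / l)\<bar>
       \<le> \<bar>?a n\<bar> + \<bar>?b n\<bar>" by (simp only: mult_1_right)
    then show ?thesis
      unfolding real_norm_def abs_mult[of "2 / l"] using l by (intro mult_mono) simp_all
  qed
  have "uniform_limit UNIV (\<lambda>N y. \<Sum>n<N. ?s n y) (\<lambda>y. \<Sum>n. ?s n y) sequentially"
    by (rule Weierstrass_m_test[OF bound M])
  then have cont: "continuous_on UNIV (\<lambda>y. \<Sum>n. ?s n y)"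
    by (rule uniform_limit_theorem[rotated])
       (use l in \<open>simp_all add: always_eventually continuous_on_sum continuous_on_add
          continuous_on_mult continuous_on_divide continuous_on_cos continuous_on_sin\<close>)
  have cl: "closure {0<..<l} = {0..l}" using l by simp
  have "(\<Sum>n. ?s n x) - \<phi> x = - (integral {0..l} \<phi> / l)"
  proof (rule continuous_constant_on_closure[where S = "{0<..<l}" and x = x
        and f = "\<lambda>y. (\<Sum>n. ?s n y) - \<phi> y"])
    show "continuous_on (closure {0<..<l}) (\<lambda>y. (\<Sum>n. ?s n y) - \<phi> y)"
      unfolding cl by (intro continuous_on_diff \<phi> continuous_on_subset[OF cont]) auto
    show "(\<Sum>n. ?s n y) - \<phi> y = - (integral {0..l} \<phi> / l)" if "y \<in> {0<..<l}" for y
      using sums_unique[OF fourier_sums_interior[OF l that \<phi> der]] that by simp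
    show "x \<in> closure {0<..<l}" using cl x by simp
  qed
  moreover have "summable (\<lambda>n. ?s n x)"
    by (rule summable_comparison_test'[OF M bound])
  ultimately show ?thesis by (simp add: sums_iff)
qed

section \<open>Classical functions on the strip and the maximum principle\<close>

text \<open>\<open>w\<close> with explicit partial derivatives; \<open>wyz\<close> is the \<open>z\<close>-derivative of \<open>wy\<close>. Unlike \<open>C2_strip\<close>, this
  is visibly closed under linear combinations.\<close>
definition jet2 ::
  "real \<Rightarrow> real \<Rightarrow> real \<Rightarrow> (real \<Rightarrow> real \<Rightarrow> real) \<Rightarrow> (real \<Rightarrow> real \<Rightarrow> real) \<Rightarrow> (real \<Rightarrow> real \<Rightarrow> real) \<Rightarrow>
   (real \<Rightarrow> real \<Rightarrow> real) \<Rightarrow> (real \<Rightarrow> real \<Rightarrow> real) \<Rightarrow> (real \<Rightarrow> real \<Rightarrow> real) \<Rightarrow> (real \<Rightarrow> real \<Rightarrow> real) \<Rightarrow> bool" where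
  "jet2 ly r R w wy wz wyy wyz wzy wzz \<longleftrightarrow>
     continuous_on (rect ly r R) (\<lambda>p. w (fst p) (snd p)) \<and>
     (\<forall>y \<in> {-ly..ly}. \<forall>z \<in> {r..R}. ((\<lambda>s. w s z) has_real_derivative wy y z) (at y within {-ly..ly})) \<and>
     (\<forall>y \<in> {-ly..ly}. \<forall>z \<in> {r<..<R}.
        ((\<lambda>t. w y t) has_real_derivative wz y z) (at z within {r..R}) \<and>
        ((\<lambda>s. wy s z) has_real_derivative wyy y z) (at y within {-ly..ly}) \<and>
        ((\<lambda>t. wy y t) has_real_derivative wyz y z) (at z within {r..R}) \<and>
        ((\<lambda>s. wz s z) has_real_derivative wzy y z) (at y within {-ly..ly}) \<and>
        ((\<lambda>t. wz y t) has_real_derivative wzz y z) (at z within {r..R})) \<and>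
     (\<forall>v \<in> {wy, wz, wyy, wyz, wzy, wzz}. continuous_on (strip ly r R) (\<lambda>p. v (fst p) (snd p)))"

lemma jet2D:
  assumes "jet2 ly r R w wy wz wyy wyz wzy wzz"
  shows "continuous_on (rect ly r R) (\<lambda>p. w (fst p) (snd p))"
    and "\<And>y z. y \<in> {-ly..ly} \<Longrightarrow> z \<in> {r..R} \<Longrightarrow> ((\<lambda>s. w s z) has_real_derivative wy y z) (at y within {-ly..ly})"
    and "\<And>y z. y \<in> {-ly..ly} \<Longrightarrow> z \<in> {r<..<R} \<Longrightarrow> ((\<lambda>t. w y t) has_real_derivative wz y z) (at z within {r..R})"
    and "\<And>y z. y \<in> {-ly..ly} \<Longrightarrow> z \<in> {r<..<R} \<Longrightarrow> ((\<lambda>s. wy s z) has_real_derivative wyy y z) (at y within {-ly..ly})"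
    and "\<And>y z. y \<in> {-ly..ly} \<Longrightarrow> z \<in> {r<..<R} \<Longrightarrow> ((\<lambda>t. wy y t) has_real_derivative wyz y z) (at z within {r..R})"
    and "\<And>y z. y \<in> {-ly..ly} \<Longrightarrow> z \<in> {r<..<R} \<Longrightarrow> ((\<lambda>s. wz s z) has_real_derivative wzy y z) (at y within {-ly..ly})"
    and "\<And>y z. y \<in> {-ly..ly} \<Longrightarrow> z \<in> {r<..<R} \<Longrightarrow> ((\<lambda>t. wz y t) has_real_derivative wzz y z) (at z within {r..R})"
    and "continuous_on (strip ly r R) (\<lambda>p. wy (fst p) (snd p))"
    and "continuous_on (strip ly r R) (\<lambda>p. wz (fst p) (snd p))"
    and "continuous_on (strip ly r R) (\<lambda>p. wyy (fst p) (snd p))"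
    and "continuous_on (strip ly r R) (\<lambda>p. wyz (fst p) (snd p))"
    and "continuous_on (strip ly r R) (\<lambda>p. wzy (fst p) (snd p))"
    and "continuous_on (strip ly r R) (\<lambda>p. wzz (fst p) (snd p))"
  using assms unfolding jet2_def by blast+

lemma jet2I:
  assumes "continuous_on (rect ly r R) (\<lambda>p. w (fst p) (snd p))"
    and "\<And>y z. y \<in> {-ly..ly} \<Longrightarrow> z \<in> {r..R} \<Longrightarrow> ((\<lambda>s. w s z) has_real_derivative wy y z) (at y within {-ly..ly})"
    and "\<And>y z. y \<in> {-ly..ly} \<Longrightarrow> z \<in> {r<..<R} \<Longrightarrow> ((\<lambda>t. w y t) has_real_derivative wz y z) (at z within {r..R})"
    and "\<And>y z. y \<in> {-ly..ly} \<Longrightarrow> z \<in> {r<..<R} \<Longrightarrow> ((\<lambda>s. wy s z) has_real_derivative wyy y z) (at y within {-ly..ly})"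
    and "\<And>y z. y \<in> {-ly..ly} \<Longrightarrow> z \<in> {r<..<R} \<Longrightarrow> ((\<lambda>t. wy y t) has_real_derivative wyz y z) (at z within {r..R})"
    and "\<And>y z. y \<in> {-ly..ly} \<Longrightarrow> z \<in> {r<..<R} \<Longrightarrow> ((\<lambda>s. wz s z) has_real_derivative wzy y z) (at y within {-ly..ly})"
    and "\<And>y z. y \<in> {-ly..ly} \<Longrightarrow> z \<in> {r<..<R} \<Longrightarrow> ((\<lambda>t. wz y t) has_real_derivative wzz y z) (at z within {r..R})"
    and "continuous_on (strip ly r R) (\<lambda>p. wy (fst p) (snd p))"
    and "continuous_on (strip ly r R) (\<lambda>p. wz (fst p) (snd p))"
    and "continuous_on (strip ly r R) (\<lambda>p. wyy (fst p) (snd p))"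
    and "continuous_on (strip ly r R) (\<lambda>p. wyz (fst p) (snd p))"
    and "continuous_on (strip ly r R) (\<lambda>p. wzy (fst p) (snd p))"
    and "continuous_on (strip ly r R) (\<lambda>p. wzz (fst p) (snd p))"
  shows "jet2 ly r R w wy wz wyy wyz wzy wzz"
  unfolding jet2_def using assms by blast

lemma Dy_works:
  "(\<lambda>s. w s z) differentiable (at y within {-ly..ly}) \<Longrightarrow>
    ((\<lambda>s. w s z) has_real_derivative Dy ly w y z) (at y within {-ly..ly})"
  by (simp add: Dy_def vector_derivative_works has_real_derivative_iff_has_vector_derivative)

lemma Dz_works:
  "(\<lambda>t. w y t) differentiable (at z within {r..R}) \<Longrightarrow>
    ((\<lambda>t. w y t) has_real_derivative Dz r R w y z) (at z within {r..R})"
  by (simp add: Dz_def vector_derivative_works has_real_derivative_iff_has_vector_derivative)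

lemma Dy_eq:
  "0 < ly \<Longrightarrow> y \<in> {-ly..ly} \<Longrightarrow> ((\<lambda>s. w s z) has_real_derivative d) (at y within {-ly..ly}) \<Longrightarrow>
    Dy ly w y z = d"
  by (auto simp: Dy_def has_real_derivative_iff_has_vector_derivative
      intro!: vector_derivative_within_closed_interval)

lemma Dz_eq:
  "r < R \<Longrightarrow> z \<in> {r..R} \<Longrightarrow> ((\<lambda>t. w y t) has_real_derivative d) (at z within {r..R}) \<Longrightarrow>
    Dz r R w y z = d"
  by (auto simp: Dz_def has_real_derivative_iff_has_vector_derivative
      intro!: vector_derivative_within_closed_interval)

lemma jet2_of_C2_strip:
  assumes "C2_strip ly r R w"
  shows "jet2 ly r R w (Dy ly w) (Dz r R w) (Dy ly (Dy ly w)) (Dz r R (Dy ly w))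
           (Dy ly (Dz r R w)) (Dz r R (Dz r R w))"
  using assms unfolding C2_strip_def jet2_def
  by (force simp: case_prod_unfold rect_def strip_def intro!: Dy_works Dz_works)

lemma jet2_derivs:
  assumes "0 < ly" "r < R" and w: "jet2 ly r R w wy wz wyy wyz wzy wzz"
  shows "\<And>y z. y \<in> {-ly..ly} \<Longrightarrow> z \<in> {r..R} \<Longrightarrow> Dy ly w y z = wy y z"
    and "\<And>y z. y \<in> {-ly..ly} \<Longrightarrow> z \<in> {r<..<R} \<Longrightarrow> Dz r R w y z = wz y z"
    and "\<And>y z. y \<in> {-ly..ly} \<Longrightarrow> z \<in> {r<..<R} \<Longrightarrow> Dy ly (Dy ly w) y z = wyy y z"
    and "\<And>y z. y \<in> {-ly..ly} \<Longrightarrow> z \<in> {r<..<R} \<Longrightarrow> Dz r R (Dy ly w) y z = wyz y z"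
    and "\<And>y z. y \<in> {-ly..ly} \<Longrightarrow> z \<in> {r<..<R} \<Longrightarrow> Dy ly (Dz r R w) y z = wzy y z"
    and "\<And>y z. y \<in> {-ly..ly} \<Longrightarrow> z \<in> {r<..<R} \<Longrightarrow> Dz r R (Dz r R w) y z = wzz y z"
    and "C2_strip ly r R w"
proof -
  show Dy: "Dy ly w y z = wy y z" if "y \<in> {-ly..ly}" "z \<in> {r..R}" for y z
    using assms that by (intro Dy_eq) (auto simp: jet2_def)
  show Dz: "Dz r R w y z = wz y z" if "y \<in> {-ly..ly}" "z \<in> {r<..<R}" for y z
    using assms that by (intro Dz_eq) (auto simp: jet2_def)
  \<comment> \<open>\<open>Dz r R w\<close> is known to agree with \<open>wz\<close> strictly
    between the two heights only. For a second derivative in \<open>z\<close> it therefore has to be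
    replaced by \<open>wz\<close> near \<open>z\<close> rather than on all of
    \<open>{r..R}\<close>.\<close>
  have ev: "\<forall>\<^sub>F t in at z within {r..R}. t \<in> {r<..<R}" if "z \<in> {r<..<R}" for z
    using filter_leD[OF at_le[OF subset_UNIV] eventually_at_in_open'[of "{r<..<R}" z]] that by simp
  have dyy: "((\<lambda>s. Dy ly w s z) has_real_derivative wyy y z) (at y within {-ly..ly})"
    and dyz: "((\<lambda>t. Dy ly w y t) has_real_derivative wyz y z) (at z within {r..R})"
    and dzy: "((\<lambda>s. Dz r R w s z) has_real_derivative wzy y z) (at y within {-ly..ly})"
    and dzz: "((\<lambda>t. Dz r R w y t) has_real_derivative wzz y z) (at z within {r..R})"
    if "y \<in> {-ly..ly}" "z \<in> {r<..<R}" for y z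
  proof -
    note w' = w[unfolded jet2_def, THEN conjunct2, THEN conjunct2, THEN conjunct1, rule_format, OF that]
    have z: "z \<in> {r..R}" using that by auto
    show "((\<lambda>s. Dy ly w s z) has_real_derivative wyy y z) (at y within {-ly..ly})"
      using w' Dy[OF _ z] that by (subst has_field_derivative_cong_eventually[where g = "\<lambda>s. wy s z"])
        (auto simp: eventually_at_filter)
    show "((\<lambda>s. Dz r R w s z) has_real_derivative wzy y z) (at y within {-ly..ly})"
      using w' Dz[OF _ that(2)] that by (subst has_field_derivative_cong_eventually[where g = "\<lambda>s. wz s z"])
        (auto simp: eventually_at_filter)
    show "((\<lambda>t. Dy ly w y t) has_real_derivative wyz y z) (at z within {r..R})"
      using w' Dy[OF that(1)] z by (subst has_field_derivative_cong_eventually[where g = "\<lambda>t. wy y t"])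
        (auto simp: eventually_at_filter)
    show "((\<lambda>t. Dz r R w y t) has_real_derivative wzz y z) (at z within {r..R})"
      using w' Dz[OF that(1)] that
      by (subst has_field_derivative_cong_eventually[where g = "\<lambda>t. wz y t"])
         (auto intro: eventually_mono[OF ev])
  qed
  show Dyy: "Dy ly (Dy ly w) y z = wyy y z" and Dyz: "Dz r R (Dy ly w) y z = wyz y z"
    and Dzy: "Dy ly (Dz r R w) y z = wzy y z" and Dzz: "Dz r R (Dz r R w) y z = wzz y z"
    if "y \<in> {-ly..ly}" "z \<in> {r<..<R}" for y z
    using that assms(1,2) by (auto intro!: Dy_eq Dz_eq dyy dyz dzy dzz)
  have cont: "continuous_on (strip ly r R) (\<lambda>(y, z). v' y z)"
    if "v \<in> {wy, wz, wyy, wyz, wzy, wzz}" "\<And>y z. y \<in> {-ly..ly} \<Longrightarrow> z \<in> {r<..<R} \<Longrightarrow> v' y z = v y z" for v v'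
  proof -
    have "continuous_on (strip ly r R) (\<lambda>p. v (fst p) (snd p))"
      using w that(1) unfolding jet2_def by blast
    then show ?thesis
      by (rule continuous_on_cong[THEN iffD1, rotated -1]) (auto simp: strip_def that(2))
  qed
  have diff: "g differentiable (at t within S)" if "(g has_real_derivative d) (at t within S)" for g d t S
    using that by (auto simp: has_real_derivative_iff_has_vector_derivative intro: differentiableI_vector)
  show "C2_strip ly r R w"
    unfolding C2_strip_def
  proof (intro conjI ballI; (clarify)?)
    show "continuous_on (rect ly r R) (\<lambda>(y, z). w y z)"
      using w by (simp add: jet2_def case_prod_unfold)
    show "continuous_on (strip ly r R) (\<lambda>(y, z). Dy ly w y z)"
      by (rule cont[of wy]) (auto simp: Dy)
    show "continuous_on (strip ly r R) (\<lambda>(y, z). Dz r R w y z)"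
      by (rule cont[of wz]) (auto simp: Dz)
    show "continuous_on (strip ly r R) (\<lambda>(y, z). Dy ly (Dy ly w) y z)"
      by (rule cont[of wyy]) (auto simp: Dyy)
    show "continuous_on (strip ly r R) (\<lambda>(y, z). Dz r R (Dy ly w) y z)"
      by (rule cont[of wyz]) (auto simp: Dyz)
    show "continuous_on (strip ly r R) (\<lambda>(y, z). Dy ly (Dz r R w) y z)"
      by (rule cont[of wzy]) (auto simp: Dzy)
    show "continuous_on (strip ly r R) (\<lambda>(y, z). Dz r R (Dz r R w) y z)"
      by (rule cont[of wzz]) (auto simp: Dzz)
    fix y z
    show "(\<lambda>s. w s z) differentiable (at y within {-ly..ly})" if "(y, z) \<in> rect ly r R"
    proof (rule diff)
      show "((\<lambda>s. w s z) has_real_derivative wy y z) (at y within {-ly..ly})"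
        using w that unfolding jet2_def rect_def by auto
    qed
    assume "(y, z) \<in> strip ly r R"
    then have yz: "y \<in> {-ly..ly}" "z \<in> {r<..<R}" by (auto simp: strip_def)
    have "w y differentiable at z within {r..R}"
      by (rule diff[OF jet2D(3)[OF w yz]])
    with diff[OF dyy[OF yz]] diff[OF dyz[OF yz]] diff[OF dzy[OF yz]] diff[OF dzz[OF yz]]
    show "w y differentiable at z within {r..R} \<and>
        (\<lambda>s. Dy ly w s z) differentiable at y within {-ly..ly} \<and>
        Dy ly w y differentiable at z within {r..R} \<and>
        (\<lambda>s. Dz r R w s z) differentiable at y within {-ly..ly} \<and>
        Dz r R w y differentiable at z within {r..R}"
      by blast
  qed
qed

lemma jet2_diff:
  assumes "jet2 ly r R w wy wz wyy wyz wzy wzz" "jet2 ly r R v vy vz vyy vyz vzy vzz"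
  shows "jet2 ly r R (\<lambda>y z. w y z - v y z) (\<lambda>y z. wy y z - vy y z) (\<lambda>y z. wz y z - vz y z)
    (\<lambda>y z. wyy y z - vyy y z) (\<lambda>y z. wyz y z - vyz y z) (\<lambda>y z. wzy y z - vzy y z) (\<lambda>y z. wzz y z - vzz y z)"
  by (rule jet2I; intro DERIV_diff continuous_on_diff jet2D[OF assms(1)] jet2D[OF assms(2)]; assumption)

lemma jet2_add:
  assumes "jet2 ly r R w wy wz wyy wyz wzy wzz" "jet2 ly r R v vy vz vyy vyz vzy vzz"
  shows "jet2 ly r R (\<lambda>y z. w y z + v y z) (\<lambda>y z. wy y z + vy y z) (\<lambda>y z. wz y z + vz y z)
    (\<lambda>y z. wyy y z + vyy y z) (\<lambda>y z. wyz y z + vyz y z) (\<lambda>y z. wzy y z + vzy y z) (\<lambda>y z. wzz y z + vzz y z)"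
  by (rule jet2I; intro DERIV_add continuous_on_add jet2D[OF assms(1)] jet2D[OF assms(2)]; assumption)

lemma jet2_mult_right:
  assumes "jet2 ly r R w wy wz wyy wyz wzy wzz"
  shows "jet2 ly r R (\<lambda>y z. w y z * c) (\<lambda>y z. wy y z * c) (\<lambda>y z. wz y z * c)
    (\<lambda>y z. wyy y z * c) (\<lambda>y z. wyz y z * c) (\<lambda>y z. wzy y z * c) (\<lambda>y z. wzz y z * c)"
  by (rule jet2I; intro DERIV_cmult_right continuous_on_mult_right jet2D[OF assms]; assumption)

text \<open>Serves two functions of the height alone: the plane \<open>m * (z - R)\<close> and the
  quadratic barrier of the maximum principle.\<close>

lemma jet2_height:
  fixes p p' p'' :: "real \<Rightarrow> real"
  assumes "\<And>t. (p has_real_derivative p' t) (at t)" "\<And>t. (p' has_real_derivative p'' t) (at t)"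
    "continuous_on UNIV p''"
  shows "jet2 ly r R (\<lambda>y z. p z) (\<lambda>y z. 0) (\<lambda>y z. p' z) (\<lambda>y z. 0) (\<lambda>y z. 0) (\<lambda>y z. 0) (\<lambda>y z. p'' z)"
proof -
  have comp: "continuous_on S (\<lambda>x. q (snd x))" if "continuous_on UNIV q"
    for q :: "real \<Rightarrow> real" and S :: "(real \<times> real) set"
    by (rule continuous_on_compose2[OF that continuous_on_snd[OF continuous_on_id]]) auto
  have "continuous_on UNIV p" "continuous_on UNIV p'"
    using assms by (auto intro: DERIV_continuous_on)
  note cont = this[THEN comp] assms(3)[THEN comp]
  show ?thesis
    by (rule jet2I) (auto intro: assms has_field_derivative_at_within[OF assms(1)]
        has_field_derivative_at_within[OF assms(2)] cont)
qed

section \<open>Maximum principle under lateral periodicity\<close>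

lemma derivative_at_maximum:
  fixes g :: "real \<Rightarrow> real"
  assumes t: "t \<in> {a..b}" and max: "\<And>s. s \<in> {a..b} \<Longrightarrow> g s \<le> g t"
    and d: "(g has_real_derivative d) (at t within {a..b})"
  shows "t < b \<Longrightarrow> d \<le> 0" and "a < t \<Longrightarrow> 0 \<le> d"
proof -
  show "d \<le> 0" if "t < b"
  proof (rule ccontr)
    assume "\<not> d \<le> 0"
    then have pos: "0 < d" by simp
    obtain e where e: "e > 0" "\<And>h. h > 0 \<Longrightarrow> t + h \<in> {a..b} \<Longrightarrow> h < e \<Longrightarrow> g t < g (t + h)"
      using has_real_derivative_pos_inc_right[OF d pos] by blast
    have "g t < g (t + min (e / 2) (b - t))"
      using e(1) that t by (intro e(2)) auto
    moreover have "g (t + min (e / 2) (b - t)) \<le> g t"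
      using e(1) that t by (intro max) auto
    ultimately show False by simp
  qed
  show "0 \<le> d" if "a < t"
  proof (rule ccontr)
    assume "\<not> 0 \<le> d"
    then have neg: "d < 0" by simp
    obtain e where e: "e > 0" "\<And>h. h > 0 \<Longrightarrow> t - h \<in> {a..b} \<Longrightarrow> h < e \<Longrightarrow> g t < g (t - h)"
      using has_real_derivative_neg_dec_left[OF d neg] by blast
    have "g t < g (t - min (e / 2) (t - a))"
      using e(1) that t by (intro e(2)) auto
    moreover have "g (t - min (e / 2) (t - a)) \<le> g t"
      using e(1) that t by (intro max) auto
    ultimately show False by simp
  qed
qed

text \<open>The point \<open>t\<close> may be an end of the interval, provided that the first
  derivative vanishes there. If \<open>c\<close> were positive, \<open>g'\<close> would be positive
  just to the right of \<open>t\<close>, or negative just to its left when \<open>t = b\<close>, and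
  the mean value theorem would produce a larger value nearby.\<close>

lemma second_derivative_at_maximum:
  fixes g g' :: "real \<Rightarrow> real"
  assumes ab: "a < b" and t: "t \<in> {a..b}" and max: "\<And>s. s \<in> {a..b} \<Longrightarrow> g s \<le> g t"
    and d: "\<And>s. s \<in> {a..b} \<Longrightarrow> (g has_real_derivative g' s) (at s within {a..b})"
    and dd: "(g' has_real_derivative c) (at t within {a..b})" and zero: "g' t = 0"
  shows "c \<le> 0"
proof (rule ccontr)
  assume "\<not> c \<le> 0"
  then have c: "0 < c" by simp
  have mvt: "\<exists>s. u < s \<and> s < v \<and> g v - g u = (v - u) * g' s" if "a \<le> u" "u < v" "v \<le> b" for u v
  proof -
    have "continuous_on {u..v} g"
      using that by (intro continuous_on_subset[OF DERIV_continuous_on[OF d]]) auto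
    moreover have "(g has_derivative (\<lambda>h. g' s * h)) (at s)" if "u < s" "s < v" for s
    proof -
      have s: "a < s" "s < b" using that \<open>a \<le> u\<close> \<open>v \<le> b\<close> by simp_all
      have "(g has_real_derivative g' s) (at s)"
        using d[of s] s unfolding at_within_Icc_at[OF s] by simp
      then show ?thesis unfolding has_field_derivative_def .
    qed
    ultimately obtain s where "u < s" "s < v" "g v - g u = g' s * (v - u)"
      by (rule mvt[OF \<open>u < v\<close>])
    then show ?thesis by (auto simp: mult.commute)
  qed
  show False
  proof (cases "t < b")
    case True
    obtain e where e: "e > 0" "\<And>h. h > 0 \<Longrightarrow> t + h \<in> {a..b} \<Longrightarrow> h < e \<Longrightarrow> g' t < g' (t + h)"
      using has_real_derivative_pos_inc_right[OF dd c] by blast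
    define h where "h = min (e / 2) (b - t)"
    have h: "0 < h" "h < e" "t + h \<le> b" using e(1) True by (auto simp: h_def)
    obtain s where s: "t < s" "s < t + h" "g (t + h) - g t = h * g' s"
      using mvt[of t "t + h"] h t by auto
    have "0 < g' s" using e(2)[of "s - t"] s h t zero by auto
    then have "0 < g (t + h) - g t" using s(3) h(1) by simp
    then show False using max[of "t + h"] h t by auto
  next
    case False
    obtain e where e: "e > 0" "\<And>h. h > 0 \<Longrightarrow> t - h \<in> {a..b} \<Longrightarrow> h < e \<Longrightarrow> g' (t - h) < g' t"
      using has_real_derivative_pos_inc_left[OF dd c] by blast
    define h where "h = min (e / 2) (t - a)"
    have h: "0 < h" "h < e" "a \<le> t - h" using e(1) False ab t by (auto simp: h_def)
    obtain s where s: "t - h < s" "s < t" "g t - g (t - h) = h * g' s"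
      using mvt[of "t - h" t] h t by auto
    have "g' s < 0" using e(2)[of "t - s"] s h t zero by auto
    then have "g t - g (t - h) < 0" using s(3) h(1) by (simp add: mult_pos_neg)
    then show False using max[of "t - h"] h t by auto
  qed
qed

text \<open>At a maximum on a lateral side periodicity forces the one-sided \<open>y\<close>-derivatives, which have opposite
  signs at the two ends, to vanish; the second derivative test then applies as at an interior point.\<close>
lemma maximum_principle_strict:
  assumes ly: "0 < ly" and rR: "r < R" and \<kappa>: "0 \<le> \<kappa>"
    and w: "jet2 ly r R w wy wz wyy wyz wzy wzz"
    and per: "\<And>z. z \<in> {r<..<R} \<Longrightarrow> w (-ly) z = w ly z" "\<And>z. z \<in> {r<..<R} \<Longrightarrow> wy (-ly) z = wy ly z"
    and bdry: "\<And>y. y \<in> {-ly..ly} \<Longrightarrow> w y r \<le> 0" "\<And>y. y \<in> {-ly..ly} \<Longrightarrow> w y R \<le> 0"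
    and pos: "\<And>y z. y \<in> {-ly..ly} \<Longrightarrow> z \<in> {r<..<R} \<Longrightarrow> 0 < wzz y z + \<kappa> * wyy y z"
    and yz: "y \<in> {-ly..ly}" "z \<in> {r..R}"
  shows "w y z \<le> 0"
proof -
  have "compact (rect ly r R)" unfolding rect_def by (intro compact_Times) auto
  moreover have "(y, z) \<in> rect ly r R" using yz by (auto simp: rect_def)
  moreover have "continuous_on (rect ly r R) (\<lambda>p. w (fst p) (snd p))"
    using w by (simp add: jet2_def)
  ultimately obtain p where p: "p \<in> rect ly r R" "\<And>q. q \<in> rect ly r R \<Longrightarrow> w (fst q) (snd q) \<le> w (fst p) (snd p)"
    using continuous_attains_sup[of "rect ly r R" "\<lambda>p. w (fst p) (snd p)"] by blast
  obtain a b where ab: "p = (a, b)" by (cases p)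
  have a: "a \<in> {-ly..ly}" and b: "b \<in> {r..R}" using p(1) by (auto simp: ab rect_def)
  have max: "w s t \<le> w a b" if "s \<in> {-ly..ly}" "t \<in> {r..R}" for s t
    using p(2)[of "(s, t)"] that by (auto simp: ab rect_def)
  have "\<not> b \<in> {r<..<R}"
  proof
    assume b': "b \<in> {r<..<R}"
    note w' = w[unfolded jet2_def, THEN conjunct2, THEN conjunct2, THEN conjunct1, rule_format]
    have dy: "((\<lambda>s. w s b) has_real_derivative wy s b) (at s within {-ly..ly})" if "s \<in> {-ly..ly}" for s
      using w that b by (auto simp: jet2_def)
    have maxper: "w s b \<le> w ly b" if "a = - ly \<or> a = ly" "s \<in> {-ly..ly}" for s
      using max[OF that(2) b] per(1)[OF b'] that(1) by auto
    have wy0: "wy a b = 0"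
    proof (cases "a = - ly \<or> a = ly")
      case True
      have "0 \<le> wy ly b"
        using ly by (intro derivative_at_maximum(2)[OF _ maxper[OF True] dy]) auto
      moreover have "wy (-ly) b \<le> 0"
        using ly by (intro derivative_at_maximum(1)[of "-ly", OF _ _ dy])
           (use maxper[OF True] per(1)[OF b'] in auto)
      ultimately show ?thesis using True per(2)[OF b'] by auto
    next
      case False
      then have "- ly < a" "a < ly" using a by auto
      then show ?thesis
        using derivative_at_maximum[OF a max[OF _ b] dy[OF a]] by auto
    qed
    have "wyy a b \<le> 0"
      using ly w'[OF a b'] by (intro second_derivative_at_maximum[OF _ a max[OF _ b] dy _ wy0]) auto
    moreover have "wzz a b \<le> 0"
    proof -
      \<comment> \<open>The second derivative test needs a first derivative throughout a closed
        interval, but \<open>z\<close>-derivatives are available strictly inside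
        \<open>{r..R}\<close> only; hence a smaller interval around \<open>b\<close>.\<close>
      let ?u = "(r + b) / 2" and ?v = "(b + R) / 2"
      have sub: "{?u..?v} \<subseteq> {r..R}" "{?u..?v} \<subseteq> {r<..<R}" "b \<in> {?u..?v}" using b' by auto
      have dz: "((\<lambda>t. w a t) has_real_derivative wz a s) (at s within {?u..?v})" if "s \<in> {?u..?v}" for s
        using w'[OF a, of s] that sub by (blast intro: DERIV_subset)
      have dzz: "((\<lambda>t. wz a t) has_real_derivative wzz a b) (at b within {?u..?v})"
        using w'[OF a b'] sub by (blast intro: DERIV_subset)
      have maxz: "w a s \<le> w a b" if "s \<in> {?u..?v}" for s
        using max[OF a] that sub by blast
      have wz0: "wz a b = 0"
        using derivative_at_maximum[OF sub(3) maxz dz[OF sub(3)]] b' by auto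
      show ?thesis
        using b' by (intro second_derivative_at_maximum[OF _ sub(3) maxz dz dzz wz0]) auto
    qed
    ultimately show False
      using pos[OF a b'] \<kappa> by (smt (verit) mult_nonneg_nonpos)
  qed
  then have "b = r \<or> b = R" using b by auto
  then have "w a b \<le> 0" using bdry[OF a] by auto
  with max[OF yz] show ?thesis by simp
qed

text \<open>The barrier \<open>e * ((z - r) * (z - R))\<close> has second derivative
  \<open>2 * e\<close>, which turns the lower bound \<open>- e\<close> into strict positivity. It
  vanishes at both heights, does not depend on \<open>y\<close> and so keeps periodicity, and never
  lies below \<open>- e * (R - r)\<^sup>2\<close>.\<close>

lemma maximum_principle_upper:
  assumes ly: "0 < ly" and rR: "r < R" and \<kappa>: "0 \<le> \<kappa>" and e: "0 < e"
    and w: "jet2 ly r R w wy wz wyy wyz wzy wzz"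
    and per: "\<And>z. z \<in> {r<..<R} \<Longrightarrow> w (-ly) z = w ly z" "\<And>z. z \<in> {r<..<R} \<Longrightarrow> wy (-ly) z = wy ly z"
    and bdry: "\<And>y. y \<in> {-ly..ly} \<Longrightarrow> w y r = 0" "\<And>y. y \<in> {-ly..ly} \<Longrightarrow> w y R = 0"
    and L: "\<And>y z. y \<in> {-ly..ly} \<Longrightarrow> z \<in> {r<..<R} \<Longrightarrow> - e \<le> wzz y z + \<kappa> * wyy y z"
    and yz: "y \<in> {-ly..ly}" "z \<in> {r..R}"
  shows "w y z \<le> e * (R - r)\<^sup>2"
proof -
  have q: "jet2 ly r R (\<lambda>y z. e * ((z - r) * (z - R))) (\<lambda>y z. 0) (\<lambda>y z. e * (2 * z - r - R)) (\<lambda>y z. 0)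
      (\<lambda>y z. 0) (\<lambda>y z. 0) (\<lambda>y z. 2 * e)"
    by (rule jet2_height) (auto intro!: derivative_eq_intros simp: algebra_simps)
  have "w y z + e * ((z - r) * (z - R)) \<le> 0"
    by (rule maximum_principle_strict[OF ly rR \<kappa> jet2_add[OF w q]])
       (use per bdry e yz L in \<open>force+\<close>)
  moreover have "(z - r) * (R - z) \<le> (R - r) * (R - r)"
    using yz by (intro mult_mono) auto
  then have "e * ((z - r) * (R - z)) \<le> e * (R - r)\<^sup>2"
    using e by (intro mult_left_mono) (auto simp: power2_eq_square)
  ultimately show ?thesis by (simp add: algebra_simps)
qed

lemma maximum_principle_bound:
  assumes ly: "0 < ly" and rR: "r < R" and \<kappa>: "0 \<le> \<kappa>" and e: "0 < e"
    and w: "jet2 ly r R w wy wz wyy wyz wzy wzz"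
    and per: "\<And>z. z \<in> {r<..<R} \<Longrightarrow> w (-ly) z = w ly z" "\<And>z. z \<in> {r<..<R} \<Longrightarrow> wy (-ly) z = wy ly z"
    and bdry: "\<And>y. y \<in> {-ly..ly} \<Longrightarrow> w y r = 0" "\<And>y. y \<in> {-ly..ly} \<Longrightarrow> w y R = 0"
    and L: "\<And>y z. y \<in> {-ly..ly} \<Longrightarrow> z \<in> {r<..<R} \<Longrightarrow> \<bar>wzz y z + \<kappa> * wyy y z\<bar> \<le> e"
    and yz: "y \<in> {-ly..ly}" "z \<in> {r..R}"
  shows "\<bar>w y z\<bar> \<le> e * (R - r)\<^sup>2"
proof -
  have L': "- e \<le> wzz s t + \<kappa> * wyy s t" "- e \<le> - wzz s t - \<kappa> * wyy s t"
    if "s \<in> {-ly..ly}" "t \<in> {r<..<R}" for s t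
    using L[OF that] by (simp_all add: abs_le_iff)
  have "w y z \<le> e * (R - r)\<^sup>2"
    by (rule maximum_principle_upper[OF ly rR \<kappa> e w per bdry L'(1) yz])
  moreover have "w y z * (- 1) \<le> e * (R - r)\<^sup>2"
    by (rule maximum_principle_upper[OF ly rR \<kappa> e jet2_mult_right[OF w] _ _ _ _ _ yz])
       (use L'(2) per bdry in \<open>simp_all\<close>)
  ultimately show ?thesis by (simp add: abs_le_iff)
qed

section \<open>Series of hyperbolic modes\<close>

lemma abs_sinh_le_exp_abs: "\<bar>sinh x\<bar> \<le> exp \<bar>x\<bar>" and abs_cosh_le_exp_abs: "\<bar>cosh x\<bar> \<le> exp \<bar>x\<bar>" for x :: real
proof -
  have "\<bar>(u - v) / 2\<bar> \<le> E \<and> \<bar>(u + v) / 2\<bar> \<le> E"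
    if "0 < u" "0 < v" "u \<le> E" "v \<le> E" for u v E :: real
    using that by (simp add: abs_le_iff)
  from this[of "exp x" "exp (- x)" "exp \<bar>x\<bar>"]
  show "\<bar>sinh x\<bar> \<le> exp \<bar>x\<bar>" "\<bar>cosh x\<bar> \<le> exp \<bar>x\<bar>"
    unfolding sinh_field_def cosh_field_def by simp_all
qed

context
  fixes a c \<sigma> h R :: real
  assumes a: "0 < a" and \<sigma>: "0 < \<sigma>"
begin

definition freq :: "nat \<Rightarrow> real" where "freq n = a * real (Suc n)"

text \<open>The flag \<open>b\<close> selects \<open>sinh\<close> or \<open>cosh\<close>. A
  derivative in \<open>z\<close> flips it, and a derivative in \<open>y\<close> swaps
  \<open>p\<close> and \<open>q\<close> up to a sign; both multiply the coefficients by the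
  frequency. Thus all derivatives of a mode series are again mode series. In the application
  \<open>a = pi / ly\<close>, \<open>c = ly\<close> and
  \<open>\<sigma> = sqrt (1 + m\<^sup>2)\<close>.\<close>

definition mode :: "(nat \<Rightarrow> real) \<Rightarrow> (nat \<Rightarrow> real) \<Rightarrow> bool \<Rightarrow> nat \<Rightarrow> real \<Rightarrow> real \<Rightarrow> real" where
  "mode p q b n y z = (p n * cos (freq n * (y + c)) + q n * sin (freq n * (y + c)))
     * (if b then sinh (\<sigma> * freq n * (R - z)) else cosh (\<sigma> * freq n * (R - z)))"

definition mode_series :: "(nat \<Rightarrow> real) \<Rightarrow> (nat \<Rightarrow> real) \<Rightarrow> bool \<Rightarrow> real \<Rightarrow> real \<Rightarrow> real" where
  "mode_series p q b y z = (\<Sum>n. mode p q b n y z)"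

text \<open>Demanding every rate strictly below \<open>h\<close>, and not \<open>h\<close> itself,
  makes the class closed under multiplication by the frequency, hence under differentiation of the
  series.\<close>

definition admissible :: "(nat \<Rightarrow> real) \<Rightarrow> bool" where
  "admissible p \<longleftrightarrow> (\<forall>\<rho><h. summable (\<lambda>n. \<bar>p n\<bar> * exp (\<sigma> * freq n * \<rho>)))"

lemma freq_pos: "0 < freq n"
  using a by (simp add: freq_def)

text \<open>One factor \<open>freq n\<close> is at most \<open>exp (d * freq n) / d\<close>, and
  this exponential is absorbed by moving from \<open>\<rho>\<close> to the midpoint
  \<open>\<rho>'\<close> between \<open>\<rho>\<close> and \<open>h\<close>. The constant
  \<open>k\<close> collects signs and powers of \<open>\<sigma>\<close>; the explicit factors
  \<open>1\<close> and \<open>- 1\<close> in the derivative formulas keep coefficients in exactly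
  this shape.\<close>

lemma admissible_freq:
  assumes p: "admissible p"
  shows "admissible (\<lambda>n. k * freq n * p n)"
  unfolding admissible_def
proof (intro allI impI)
  fix \<rho> assume \<rho>: "\<rho> < h"
  define \<rho>' where "\<rho>' = (\<rho> + h) / 2"
  define d where "d = \<sigma> * (\<rho>' - \<rho>)"
  have \<rho>': "\<rho> < \<rho>'" "\<rho>' < h" using \<rho> by (auto simp: \<rho>'_def)
  then have d: "0 < d" using \<sigma> by (simp add: d_def)
  show "summable (\<lambda>n. \<bar>k * freq n * p n\<bar> * exp (\<sigma> * freq n * \<rho>))"
  proof (rule summable_comparison_test')
    show "summable (\<lambda>n. \<bar>k\<bar> / d * (\<bar>p n\<bar> * exp (\<sigma> * freq n * \<rho>')))"
      using p \<rho>' by (intro summable_mult) (simp add: admissible_def)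
    fix n
    have "d * freq n \<le> exp (d * freq n)"
      using exp_ge_add_one_self[of "d * freq n"] by linarith
    then have "freq n \<le> exp (d * freq n) / d" using d by (simp add: field_simps)
    then have "freq n * exp (\<sigma> * freq n * \<rho>) \<le> exp (d * freq n) / d * exp (\<sigma> * freq n * \<rho>)"
      by (rule mult_right_mono) simp
    also have "\<dots> = exp (\<sigma> * freq n * \<rho>') / d"
      by (simp add: exp_add[symmetric] d_def algebra_simps)
    finally have "(\<bar>k\<bar> * \<bar>p n\<bar>) * (freq n * exp (\<sigma> * freq n * \<rho>)) \<le> (\<bar>k\<bar> * \<bar>p n\<bar>) * (exp (\<sigma> * freq n * \<rho>') / d)"
      by (rule mult_left_mono) simp
    then show "norm (\<bar>k * freq n * p n\<bar> * exp (\<sigma> * freq n * \<rho>)) \<le> \<bar>k\<bar> / d * (\<bar>p n\<bar> * exp (\<sigma> * freq n * \<rho>'))"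
      using freq_pos[of n] by (simp add: abs_mult mult_ac)
  qed
qed

lemma mode_bound:
  assumes "\<bar>R - z\<bar> \<le> \<rho>"
  shows "norm (mode p q b n y z) \<le> \<bar>p n\<bar> * exp (\<sigma> * freq n * \<rho>) + \<bar>q n\<bar> * exp (\<sigma> * freq n * \<rho>)"
proof -
  have "\<bar>p n * cos (freq n * (y + c)) + q n * sin (freq n * (y + c))\<bar>
      \<le> \<bar>p n\<bar> * \<bar>cos (freq n * (y + c))\<bar> + \<bar>q n\<bar> * \<bar>sin (freq n * (y + c))\<bar>"
    unfolding abs_mult[symmetric] by (rule abs_triangle_ineq)
  also have "\<dots> \<le> \<bar>p n\<bar> * 1 + \<bar>q n\<bar> * 1"
    by (intro add_mono mult_left_mono) auto
  finally have 1: "\<bar>p n * cos (freq n * (y + c)) + q n * sin (freq n * (y + c))\<bar> \<le> \<bar>p n\<bar> + \<bar>q n\<bar>"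
    by simp
  have "\<sigma> * freq n * \<bar>R - z\<bar> \<le> \<sigma> * freq n * \<rho>"
    using \<sigma> freq_pos[of n] assms by (intro mult_left_mono) auto
  then have "\<bar>\<sigma> * freq n * (R - z)\<bar> \<le> \<sigma> * freq n * \<rho>"
    using \<sigma> freq_pos[of n] by (simp add: abs_mult)
  then have "exp \<bar>\<sigma> * freq n * (R - z)\<bar> \<le> exp (\<sigma> * freq n * \<rho>)" by simp
  then have 2: "\<bar>if b then sinh (\<sigma> * freq n * (R - z)) else cosh (\<sigma> * freq n * (R - z))\<bar> \<le> exp (\<sigma> * freq n * \<rho>)"
    using abs_sinh_le_exp_abs abs_cosh_le_exp_abs order_trans by (cases b) (simp_all, blast+)
  show ?thesis
    unfolding mode_def real_norm_def abs_mult distrib_right[symmetric] by (rule mult_mono[OF 1 2]) auto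
qed

lemma summable_bound:
  assumes "admissible p" "admissible q" "\<rho> < h"
  shows "summable (\<lambda>n. \<bar>p n\<bar> * exp (\<sigma> * freq n * \<rho>) + \<bar>q n\<bar> * exp (\<sigma> * freq n * \<rho>))"
  using assms by (intro summable_add) (auto simp: admissible_def)

lemma summable_mode:
  assumes "admissible p" "admissible q" "\<bar>R - z\<bar> < h"
  shows "summable (\<lambda>n. mode p q b n y z)"
  by (rule summable_comparison_test'[OF summable_bound[OF assms]], rule mode_bound) simp

lemma mode_series_deriv_y:
  assumes p: "admissible p" and q: "admissible q" and z: "\<bar>R - z\<bar> < h"
  shows "((\<lambda>s. mode_series p q b s z) has_real_derivative
    mode_series (\<lambda>n. 1 * freq n * q n) (\<lambda>n. - 1 * freq n * p n) b y z) (at y within S)"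
  unfolding mode_series_def
proof (rule has_field_derivative_at_within, rule has_field_derivative_series'(2)[where S = UNIV])
  show "((\<lambda>s. mode p q b n s z) has_field_derivative
      mode (\<lambda>n. 1 * freq n * q n) (\<lambda>n. - 1 * freq n * p n) b n s z) (at s within UNIV)" for n s
    unfolding mode_def by (auto intro!: derivative_eq_intros simp: algebra_simps)
  show "uniformly_convergent_on UNIV
     (\<lambda>N s. \<Sum>n<N. mode (\<lambda>n. 1 * freq n * q n) (\<lambda>n. - 1 * freq n * p n) b n s z)"
    by (rule Weierstrass_m_test'[OF _ summable_bound[OF admissible_freq[OF q] admissible_freq[OF p] z]],
        rule mode_bound) simp
  show "summable (\<lambda>n. mode p q b n 0 z)"
    by (rule summable_mode[OF p q z])
qed auto

lemma mode_series_deriv_z: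
  assumes p: "admissible p" and q: "admissible q" and z: "\<bar>R - z\<bar> < h"
  shows "((\<lambda>t. mode_series p q b y t) has_real_derivative
    mode_series (\<lambda>n. - \<sigma> * freq n * p n) (\<lambda>n. - \<sigma> * freq n * q n) (\<not> b) y z) (at z within S)"
  unfolding mode_series_def
proof -
  \<comment> \<open>Unlike in \<open>y\<close>, the dominating series depends on the height. A
    radius strictly between the distance of \<open>z\<close> from \<open>R\<close> and
    \<open>h\<close> gives a neighbourhood of \<open>z\<close> with one summable majorant.\<close>
  define \<rho> where "\<rho> = (\<bar>R - z\<bar> + h) / 2"
  have \<rho>: "\<bar>R - z\<bar> < \<rho>" "\<rho> < h" using z by (auto simp: \<rho>_def)
  let ?S = "{R - \<rho><..<R + \<rho>}"
  have S: "\<bar>R - t\<bar> \<le> \<rho>" if "t \<in> ?S" for t using that by auto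
  have zS: "z \<in> ?S" using \<rho> by auto
  have "((\<lambda>t. \<Sum>n. mode p q b n y t) has_real_derivative
      (\<Sum>n. mode (\<lambda>n. - \<sigma> * freq n * p n) (\<lambda>n. - \<sigma> * freq n * q n) (\<not> b) n y z)) (at z)"
  proof (rule has_field_derivative_series'(2)[where S = ?S])
    show "((\<lambda>t. mode p q b n y t) has_field_derivative
        mode (\<lambda>n. - \<sigma> * freq n * p n) (\<lambda>n. - \<sigma> * freq n * q n) (\<not> b) n y t) (at t within ?S)" for n t
      unfolding mode_def
      by (cases b) ((rule derivative_eq_intros refl | simp)+, simp add: algebra_simps)+
    show "uniformly_convergent_on ?S
       (\<lambda>N t. \<Sum>n<N. mode (\<lambda>n. - \<sigma> * freq n * p n) (\<lambda>n. - \<sigma> * freq n * q n) (\<not> b) n y t)"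
      by (rule Weierstrass_m_test'[OF _ summable_bound[OF admissible_freq[OF p] admissible_freq[OF q] \<rho>(2)]],
          rule mode_bound, rule S)
    show "summable (\<lambda>n. mode p q b n y z)"
      by (rule summable_mode[OF p q z])
  qed (use zS in auto)
  then show "((\<lambda>t. \<Sum>n. mode p q b n y t) has_real_derivative
      (\<Sum>n. mode (\<lambda>n. - \<sigma> * freq n * p n) (\<lambda>n. - \<sigma> * freq n * q n) (\<not> b) n y z)) (at z within S)"
    by (rule has_field_derivative_at_within)
qed

lemma mode_series_continuous:
  assumes p: "admissible p" and q: "admissible q"
    and T: "\<And>y z. (y, z) \<in> T \<Longrightarrow> \<bar>R - z\<bar> < h"
  shows "continuous_on T (\<lambda>v. mode_series p q b (fst v) (snd v))"
proof (rule continuous_at_imp_continuous_on, rule ballI)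
  fix v assume "v \<in> T"
  then have v: "\<bar>R - snd v\<bar> < h" using T[of "fst v" "snd v"] by simp
  define \<rho> where "\<rho> = (\<bar>R - snd v\<bar> + h) / 2"
  have \<rho>: "\<bar>R - snd v\<bar> < \<rho>" "\<rho> < h" using v by (auto simp: \<rho>_def)
  let ?S = "UNIV \<times> {R - \<rho><..<R + \<rho>} :: (real \<times> real) set"
  have S: "\<bar>R - snd w\<bar> \<le> \<rho>" if "w \<in> ?S" for w using that by auto
  have "uniform_limit ?S (\<lambda>N w. \<Sum>n<N. mode p q b n (fst w) (snd w))
      (\<lambda>w. \<Sum>n. mode p q b n (fst w) (snd w)) sequentially"
    by (rule Weierstrass_m_test[OF _ summable_bound[OF p q \<rho>(2)]], rule mode_bound, rule S)
  moreover have "continuous_on ?S (\<lambda>w. \<Sum>n<N. mode p q b n (fst w) (snd w))" for N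
    unfolding mode_def by (cases b) (auto intro!: continuous_intros)
  ultimately have "continuous_on ?S (\<lambda>v. mode_series p q b (fst v) (snd v))"
    unfolding mode_series_def by (intro uniform_limit_theorem[rotated]) auto
  moreover have "open ?S" by (intro open_Times) auto
  moreover have "v \<in> ?S" using \<rho> by (cases v) auto
  ultimately show "isCont (\<lambda>v. mode_series p q b (fst v) (snd v)) v"
    using continuous_on_eq_continuous_at by blast
qed

lemma mode_series_laplace:
  assumes p: "admissible p" and q: "admissible q" and z: "\<bar>R - z\<bar> < h"
  shows "mode_series (\<lambda>n. - \<sigma> * freq n * (- \<sigma> * freq n * p n)) (\<lambda>n. - \<sigma> * freq n * (- \<sigma> * freq n * q n)) b y z
     + \<sigma>\<^sup>2 * mode_series (\<lambda>n. 1 * freq n * (- 1 * freq n * p n)) (\<lambda>n. - 1 * freq n * (1 * freq n * q n)) b y z = 0"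
proof -
  have "mode (\<lambda>n. - \<sigma> * freq n * (- \<sigma> * freq n * p n)) (\<lambda>n. - \<sigma> * freq n * (- \<sigma> * freq n * q n)) b n y z
     = - (\<sigma>\<^sup>2 * mode (\<lambda>n. 1 * freq n * (- 1 * freq n * p n)) (\<lambda>n. - 1 * freq n * (1 * freq n * q n)) b n y z)" for n
    unfolding mode_def by (simp add: power2_eq_square algebra_simps)
  moreover have "summable (\<lambda>n. mode (\<lambda>n. 1 * freq n * (- 1 * freq n * p n)) (\<lambda>n. - 1 * freq n * (1 * freq n * q n)) b n y z)"
    by (intro summable_mode admissible_freq p q z)
  ultimately show ?thesis
    unfolding mode_series_def by (simp add: suminf_minus suminf_mult summable_mult)
qed

lemma mode_series_periodic:
  assumes "a * c = pi"
  shows "mode_series p q b (-c) z = mode_series p q b c z"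
proof -
  have "freq n * (c + c) = 2 * pi * int (Suc n)" for n
    by (simp add: freq_def assms[symmetric])
  then have "cos (freq n * (c + c)) = 1" "sin (freq n * (c + c)) = 0" for n
    by (simp_all only: cos_int_2pin sin_int_2pin)
  then have "mode p q b n (-c) z = mode p q b n c z" for n
    by (simp add: mode_def)
  then show ?thesis by (simp add: mode_series_def)
qed

lemma mode_series_at_zero: "mode_series p q True y R = 0"
  by (simp add: mode_series_def mode_def)

end

text \<open>\<open>sinh x\<close> is \<open>exp x * (1 - exp (- 2 * x)) / 2\<close>, and the bracket
  increases with \<open>x\<close>. Away from zero, division by \<open>sinh\<close> is therefore as
  good as exponential decay.\<close>

lemma inverse_sinh_le:
  fixes x x0 :: real
  assumes "0 < x0" "x0 \<le> x"
  shows "1 / sinh x \<le> 2 / (1 - exp (- 2 * x0)) * exp (- x)"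
proof -
  have 0: "0 < 1 - exp (- 2 * x0)" using assms by simp
  have "exp (- x) = exp x * exp (- 2 * x)" by (simp add: exp_add[symmetric])
  also have "\<dots> \<le> exp x * exp (- 2 * x0)" using assms by simp
  finally have "exp x * (1 - exp (- 2 * x0)) / 2 \<le> sinh x"
    unfolding sinh_field_def right_diff_distrib mult_1_right by (intro divide_right_mono) auto
  then have "1 / sinh x \<le> 1 / (exp x * (1 - exp (- 2 * x0)) / 2)"
    using 0 by (intro divide_left_mono) (auto intro!: mult_pos_pos simp: assms less_le_trans[OF assms])
  also have "\<dots> = 2 / (1 - exp (- 2 * x0)) * exp (- x)"
    by (simp add: exp_minus field_simps)
  finally show ?thesis .
qed

lemma admissible_div_sinh:
  assumes a: "0 < a" and \<sigma>: "0 < \<sigma>" and h: "0 < h" and A: "summable (\<lambda>n. \<bar>A n\<bar>)"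
  shows "admissible a \<sigma> h (\<lambda>n. A n / sinh (\<sigma> * freq a n * h))"
proof -
  \<comment> \<open>All arguments of \<open>sinh\<close> are at least
    \<open>\<sigma> * a * h\<close>, the one belonging to the lowest frequency, so a single constant
    serves every \<open>n\<close>.\<close>
  define C where "C = 2 / (1 - exp (- 2 * (\<sigma> * a * h)))"
  have C: "0 < C" using a \<sigma> h by (simp add: C_def)
  show ?thesis
    unfolding admissible_def[OF a \<sigma>]
  proof (intro allI impI)
    fix \<rho> assume \<rho>: "\<rho> < h"
    show "summable (\<lambda>n. \<bar>A n / sinh (\<sigma> * freq a n * h)\<bar> * exp (\<sigma> * freq a n * \<rho>))"
    proof (rule summable_comparison_test'[OF summable_mult[OF A, of C]])
      fix n :: nat
      have f: "a \<le> freq a n" using a by (simp add: freq_def[OF a \<sigma>])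
      have x: "\<sigma> * a * h \<le> \<sigma> * freq a n * h" "0 < \<sigma> * a * h"
        using f a \<sigma> h by (auto intro!: mult_left_mono mult_right_mono)
      then have s: "0 < sinh (\<sigma> * freq a n * h)" by simp
      have "1 / sinh (\<sigma> * freq a n * h) * exp (\<sigma> * freq a n * \<rho>)
          \<le> C * exp (- (\<sigma> * freq a n * h)) * exp (\<sigma> * freq a n * \<rho>)"
        unfolding C_def by (rule mult_right_mono[OF inverse_sinh_le[OF x(2,1)]]) simp
      also have "\<dots> = C * exp (\<sigma> * freq a n * (\<rho> - h))"
        by (simp add: exp_add[symmetric] algebra_simps)
      also have "\<dots> \<le> C * 1"
      proof -
        have "\<sigma> * freq a n * (\<rho> - h) \<le> 0"
          using \<sigma> f a \<rho> by (intro mult_nonneg_nonpos) auto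
        then show ?thesis using C by (intro mult_left_mono) auto
      qed
      finally have "\<bar>A n\<bar> * (1 / sinh (\<sigma> * freq a n * h) * exp (\<sigma> * freq a n * \<rho>)) \<le> \<bar>A n\<bar> * (C * 1)"
        by (rule mult_left_mono) simp
      then show "norm (\<bar>A n / sinh (\<sigma> * freq a n * h)\<bar> * exp (\<sigma> * freq a n * \<rho>)) \<le> C * \<bar>A n\<bar>"
        using s by (simp add: abs_mult mult_ac)
    qed
  qed
qed

section \<open>Fourier data of the rescaled trace\<close>

lemma rescaled_trace_has_derivative:
  assumes ly: "0 < ly" and t: "t \<in> {0..period ly r R f}"
    and f': "\<And>y. y \<in> {-ly..ly} \<Longrightarrow> (f has_real_derivative f' y) (at y within {-ly..ly})"
  defines "s \<equiv> sqrt (1 + (slope ly r R f)\<^sup>2)"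
  shows "(rescaled_trace ly r R f has_real_derivative f' (s * t - ly) * s) (at t within {0..period ly r R f})"
proof -
  have s: "0 < s" unfolding s_def by (simp add: add_pos_nonneg)
  have range: "s * t - ly \<in> {-ly..ly}" if "t \<in> {0..period ly r R f}" for t
  proof -
    have "0 \<le> s * t" "s * t \<le> s * period ly r R f" using that s by auto
    moreover have "s * period ly r R f = 2 * ly" using s by (simp add: period_def s_def)
    ultimately show ?thesis by auto
  qed
  have "(f has_real_derivative f' (s * t - ly)) (at (s * t - ly) within (\<lambda>t. s * t - ly) ` {0..period ly r R f})"
    by (rule DERIV_subset[OF f'[OF range[OF t]]]) (use range in auto)
  then have "((f \<circ> (\<lambda>t. s * t - ly)) has_real_derivative f' (s * t - ly) * s) (at t within {0..period ly r R f})"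
    by (rule DERIV_image_chain) (auto intro!: derivative_eq_intros)
  then have "((\<lambda>t. (f \<circ> (\<lambda>t. s * t - ly)) t - slope ly r R f * (r - R)) has_real_derivative
      f' (s * t - ly) * s - 0) (at t within {0..period ly r R f})"
    by (rule DERIV_diff[OF _ DERIV_const])
  then show ?thesis by (simp add: rescaled_trace_def[abs_def] s_def o_def)
qed

text \<open>The slope is defined so that \<open>slope ly r R f * (r - R)\<close> is the mean of
  \<open>f\<close>. This is why the series for the trace has no term with
  \<open>n = 0\<close>.\<close>

lemma integral_rescaled_trace:
  assumes ly: "0 < ly" and rR: "r < R" and f: "continuous_on {-ly..ly} f"
  shows "integral {0..period ly r R f} (rescaled_trace ly r R f) = 0"
proof -
  define s where "s = sqrt (1 + (slope ly r R f)\<^sup>2)"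
  have s: "0 < s" unfolding s_def by (simp add: add_pos_nonneg)
  have l: "period ly r R f = 2 * ly / s" by (simp add: period_def s_def)
  have "(f has_integral integral {-ly..ly} f) (cbox (-ly) ly)"
    using integrable_integral[OF integrable_continuous_interval[OF f]] by simp
  from has_integral_affinity'[OF this s, of "- ly"]
  have "((\<lambda>t. f (s * t - ly)) has_integral integral {-ly..ly} f / s) {0..period ly r R f}"
    by (simp add: l field_simps)
  from has_integral_diff[OF this has_integral_const_real[of "slope ly r R f * (r - R)" 0 "period ly r R f"]]
  have "(rescaled_trace ly r R f has_integral
      integral {-ly..ly} f / s - period ly r R f * (slope ly r R f * (r - R))) {0..period ly r R f}"
    using ly s by (simp add: rescaled_trace_def[abs_def] s_def[symmetric] l)
  moreover have "slope ly r R f * (r - R) = integral {-ly..ly} f / (2 * ly)"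
    using rR by (simp add: slope_def)
  ultimately show ?thesis
    using ly s by (simp add: l integral_unique)
qed

lemma fourier_coeff_trace:
  assumes ly: "0 < ly" and rR: "r < R" and f: "periodic_C1 ly f"
  shows "summable (\<lambda>n. \<bar>cos_coeff ly r R f (Suc n)\<bar>)"
    and "summable (\<lambda>n. \<bar>sin_coeff ly r R f (Suc n)\<bar>)"
    and "y \<in> {-ly..ly} \<Longrightarrow>
      (\<lambda>n. cos_coeff ly r R f (Suc n) * cos (pi * real (Suc n) * ((y + ly) / ly))
         + sin_coeff ly r R f (Suc n) * sin (pi * real (Suc n) * ((y + ly) / ly)))
      sums (f y - slope ly r R f * (r - R))"
proof -
  obtain f' where f': "\<And>y. y \<in> {-ly..ly} \<Longrightarrow> (f has_real_derivative f' y) (at y within {-ly..ly})"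
    and cont: "continuous_on {-ly..ly} f'" and per: "f (-ly) = f ly"
    using f unfolding periodic_C1_def by blast
  define s where "s = sqrt (1 + (slope ly r R f)\<^sup>2)"
  have s: "0 < s" unfolding s_def by (simp add: add_pos_nonneg)
  define l where "l = period ly r R f"
  have l: "l = 2 * ly / s" by (simp add: period_def s_def l_def)
  then have l0: "0 < l" using ly s by simp
  let ?\<phi> = "rescaled_trace ly r R f"
  have der: "(?\<phi> has_real_derivative f' (s * t - ly) * s) (at t within {0..l})" if "t \<in> {0..l}" for t
    using rescaled_trace_has_derivative[OF ly that[unfolded l_def] f'] by (simp add: s_def l_def)
  have "s * t - ly \<in> {-ly..ly}" if "t \<in> {0..l}" for t
  proof -
    have "0 \<le> s * t" "s * t \<le> s * l" using that s by auto
    moreover have "s * l = 2 * ly" using s by (simp add: l)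
    ultimately show ?thesis by auto
  qed
  then have dcont: "continuous_on {0..l} (\<lambda>t. f' (s * t - ly) * s)"
    by (intro continuous_on_mult_right continuous_on_compose2[OF cont] continuous_intros) auto
  have ends: "?\<phi> 0 = ?\<phi> l"
    using s per by (simp add: rescaled_trace_def s_def[symmetric] l)
  note summ = summable_fourier_coeff[OF l0 der dcont ends]
  show "summable (\<lambda>n. \<bar>cos_coeff ly r R f (Suc n)\<bar>)"
    using summable_mult[OF summ(1), of "2 / l"] l0
    by (simp only: cos_coeff_def l_def[symmetric] Let_def abs_mult) simp
  show "summable (\<lambda>n. \<bar>sin_coeff ly r R f (Suc n)\<bar>)"
    using summable_mult[OF summ(2), of "2 / l"] l0
    by (simp only: sin_coeff_def l_def[symmetric] Let_def abs_mult) simp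
  assume y: "y \<in> {-ly..ly}"
  \<comment> \<open>The point that the rescaling \<open>s * x - ly\<close> sends to
    \<open>y\<close>; it converts the phase on \<open>{0..l}\<close> into the phase of the stated
    series.\<close>
  define x where "x = (y + ly) / s"
  have x: "x \<in> {0..l}" using y s by (auto simp: x_def l divide_right_mono)
  have phase: "2 * pi * real (Suc n) * x / l = pi * real (Suc n) * ((y + ly) / ly)" for n
    using s ly by (simp add: x_def l)
  have "continuous_on {-ly..ly} f" using f' by (meson DERIV_continuous_on)
  then have "integral {0..l} ?\<phi> = 0"
    unfolding l_def by (rule integral_rescaled_trace[OF ly rR])
  moreover have "?\<phi> x = f y - slope ly r R f * (r - R)"
    using s by (simp add: rescaled_trace_def s_def[symmetric] x_def)
  ultimately show "(\<lambda>n. cos_coeff ly r R f (Suc n) * cos (pi * real (Suc n) * ((y + ly) / ly))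
         + sin_coeff ly r R f (Suc n) * sin (pi * real (Suc n) * ((y + ly) / ly)))
      sums (f y - slope ly r R f * (r - R))"
    using fourier_sums[OF l0 x der dcont ends, unfolded phase]
    by (simp only: cos_coeff_def sin_coeff_def l_def[symmetric] Let_def distrib_left mult.assoc) simp
qed

section \<open>The series as a classical solution\<close>

proposition fourier_solution:
  assumes ly: "0 < ly" and rR: "r < R" and f: "periodic_C1 ly f"
  defines "m \<equiv> slope ly r R f"
  defines "S \<equiv> \<lambda>y z. \<Sum>n. fourier_mode ly r R f (Suc n) y z"
  shows "\<And>y z. y \<in> {-ly..ly} \<Longrightarrow> z \<in> {r..R} \<Longrightarrow> summable (\<lambda>n. fourier_mode ly r R f (Suc n) y z)"
    and "\<And>y. y \<in> {-ly..ly} \<Longrightarrow> S y r = f y - m * (r - R)"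
    and "\<And>y. S y R = 0"
    and "\<And>z. S (-ly) z = S ly z"
    and "\<exists>wy wz wyy wyz wzy wzz. jet2 ly r R S wy wz wyy wyz wzy wzz \<and>
      (\<forall>z \<in> {r..R}. wy (-ly) z = wy ly z) \<and>
      (\<forall>y \<in> {-ly..ly}. \<forall>z \<in> {r<..<R}. wzz y z + (1 + m\<^sup>2) * wyy y z = 0)"
proof -
  define \<sigma> where "\<sigma> = sqrt (1 + m\<^sup>2)"
  have \<sigma>: "0 < \<sigma>" unfolding \<sigma>_def by (simp add: add_pos_nonneg)
  have \<sigma>2: "\<sigma>\<^sup>2 = 1 + m\<^sup>2" unfolding \<sigma>_def by simp
  define a where "a = pi / ly"
  have a: "0 < a" "a * ly = pi" using ly by (auto simp: a_def)
  define h where "h = R - r"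
  have h: "0 < h" using rR by (simp add: h_def)
  define A where "A = (\<lambda>n. cos_coeff ly r R f (Suc n))"
  define B where "B = (\<lambda>n. sin_coeff ly r R f (Suc n))"
  have AB: "summable (\<lambda>n. \<bar>A n\<bar>)" "summable (\<lambda>n. \<bar>B n\<bar>)"
    unfolding A_def B_def by (rule fourier_coeff_trace[OF ly rR f])+
  define p where "p = (\<lambda>n. A n / sinh (\<sigma> * freq a n * h))"
  define q where "q = (\<lambda>n. B n / sinh (\<sigma> * freq a n * h))"
  have pq: "admissible a \<sigma> h p" "admissible a \<sigma> h q"
    unfolding p_def q_def by (intro admissible_div_sinh a \<sigma> h AB)+
  have fr: "freq a n = pi * real (Suc n) / ly" for n
    by (simp only: freq_def[OF a(1) \<sigma>]) (simp add: a_def)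
  have fpos: "0 < \<sigma> * freq a n" for n
    using freq_pos[OF a(1) \<sigma>] \<sigma> by simp
  have mode_eq: "fourier_mode ly r R f (Suc n) y z = mode a ly \<sigma> R p q True n y z" for n y z
  proof -
    have 1: "pi * real (Suc n) * ((y + ly) / ly) = freq a n * (y + ly)"
      unfolding fr by simp
    have 2: "2 * pi * real (Suc n) * (R - r) / period ly r R f = \<sigma> * freq a n * h"
      unfolding fr period_def \<sigma>_def m_def h_def by simp
    have 3: "pi * real (Suc n) * sqrt (1 + (slope ly r R f)\<^sup>2) * ((R - z) / ly) = \<sigma> * freq a n * (R - z)"
      unfolding fr \<sigma>_def m_def by simp
    show ?thesis
      unfolding fourier_mode_def 1 2 3 mode_def[OF a(1) \<sigma>] p_def q_def A_def B_def
      by (simp add: add_divide_distrib)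
  qed
  have S: "S = mode_series a ly \<sigma> R p q True"
    unfolding S_def mode_eq mode_series_def[OF a(1) \<sigma>, abs_def] ..
  \<comment> \<open>For \<open>z\<close> in \<open>{r..R}\<close> the quotient of the two hyperbolic
    sines is at most 1, so the summable coefficients alone dominate the modes, with
    \<open>z = r\<close> included.\<close>
  have bound: "norm (fourier_mode ly r R f (Suc n) y z) \<le> \<bar>A n\<bar> + \<bar>B n\<bar>" if "z \<in> {r..R}" for n y z
  proof -
    have "\<bar>p n * cos (freq a n * (y + ly)) + q n * sin (freq a n * (y + ly))\<bar>
        \<le> \<bar>p n\<bar> * \<bar>cos (freq a n * (y + ly))\<bar> + \<bar>q n\<bar> * \<bar>sin (freq a n * (y + ly))\<bar>"
      unfolding abs_mult[symmetric] by (rule abs_triangle_ineq)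
    also have "\<dots> \<le> \<bar>p n\<bar> * 1 + \<bar>q n\<bar> * 1"
      by (intro add_mono mult_left_mono) auto
    finally have 1: "\<bar>p n * cos (freq a n * (y + ly)) + q n * sin (freq a n * (y + ly))\<bar> \<le> \<bar>p n\<bar> + \<bar>q n\<bar>"
      by simp
    have z: "0 \<le> \<sigma> * freq a n * (R - z)" "\<sigma> * freq a n * (R - z) \<le> \<sigma> * freq a n * h"
      using that mult_nonneg_nonneg[OF less_imp_le[OF fpos[of n]], of "R - z"]
        mult_left_mono[OF _ less_imp_le[OF fpos[of n]], of "R - z" h] by (simp_all add: h_def)
    then have 2: "\<bar>sinh (\<sigma> * freq a n * (R - z))\<bar> \<le> sinh (\<sigma> * freq a n * h)" by simp
    have "\<bar>t / d\<bar> * d = \<bar>t\<bar>" if "0 < d" for t d :: real using that by simp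
    moreover have "0 < sinh (\<sigma> * freq a n * h)" using fpos[of n] h by simp
    ultimately have "(\<bar>p n\<bar> + \<bar>q n\<bar>) * sinh (\<sigma> * freq a n * h) = \<bar>A n\<bar> + \<bar>B n\<bar>"
      unfolding p_def q_def distrib_right by (simp only:)
    moreover have "norm (mode a ly \<sigma> R p q True n y z) \<le> (\<bar>p n\<bar> + \<bar>q n\<bar>) * sinh (\<sigma> * freq a n * h)"
      unfolding mode_def[OF a(1) \<sigma>] real_norm_def abs_mult if_True by (rule mult_mono[OF 1 2]) auto
    ultimately show ?thesis by (simp add: mode_eq)
  qed
  show "summable (\<lambda>n. fourier_mode ly r R f (Suc n) y z)" if "y \<in> {-ly..ly}" "z \<in> {r..R}" for y z
    by (rule summable_comparison_test'[OF summable_add[OF AB]], rule bound, rule that)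
  show S_r: "S y r = f y - m * (r - R)" if "y \<in> {-ly..ly}" for y
  proof -
    have "0 < sinh (\<sigma> * freq a n * h)" for n using fpos[of n] h by simp
    then have "sinh (\<sigma> * freq a n * h) \<noteq> 0" for n by (metis less_irrefl)
    moreover have "2 * pi * real (Suc n) * (R - r) / period ly r R f = \<sigma> * freq a n * h" for n
      unfolding fr period_def \<sigma>_def m_def h_def by simp
    moreover have "pi * real (Suc n) * sqrt (1 + (slope ly r R f)\<^sup>2) * ((R - r) / ly) = \<sigma> * freq a n * h" for n
      unfolding fr \<sigma>_def m_def h_def by simp
    ultimately have "fourier_mode ly r R f (Suc n) y r =
        cos_coeff ly r R f (Suc n) * cos (pi * real (Suc n) * ((y + ly) / ly))
         + sin_coeff ly r R f (Suc n) * sin (pi * real (Suc n) * ((y + ly) / ly))" for n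
      unfolding fourier_mode_def by simp
    then show ?thesis
      unfolding S_def m_def using sums_unique[OF fourier_coeff_trace(3)[OF ly rR f that]] by simp
  qed
  show S_R: "S y R = 0" for y
    unfolding S by (rule mode_series_at_zero[OF a(1) \<sigma>])
  show "S (-ly) z = S ly z" for z
    unfolding S by (rule mode_series_periodic[OF a(1) \<sigma> a(2)])
  obtain f' where f': "\<And>y. y \<in> {-ly..ly} \<Longrightarrow> (f has_real_derivative f' y) (at y within {-ly..ly})"
    and per: "f' (-ly) = f' ly"
    using f unfolding periodic_C1_def by blast
  note dy = mode_series_deriv_y[OF a(1) \<sigma>] and dz = mode_series_deriv_z[OF a(1) \<sigma>]
    and adm = admissible_freq[OF a(1) \<sigma>]
  let ?U = "mode_series a ly \<sigma> R"
  let ?k = "\<lambda>k p n. k * freq a n * p n"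
  \<comment> \<open>At \<open>z = r\<close> the differentiated series need not converge. There the
    sum equals the trace up to a constant, so its derivative is \<open>f'\<close>, and the
    periodicity of \<open>f'\<close> supplies the lateral condition at that height.\<close>
  define wy where "wy = (\<lambda>y z. if z = r then f' y else ?U (?k 1 q) (?k (- 1) p) True y z)"
  define wz where "wz = ?U (?k (- \<sigma>) p) (?k (- \<sigma>) q) False"
  define wyy where "wyy = ?U (?k 1 (?k (- 1) p)) (?k (- 1) (?k 1 q)) True"
  define wyz where "wyz = ?U (?k (- \<sigma>) (?k 1 q)) (?k (- \<sigma>) (?k (- 1) p)) False"
  define wzy where "wzy = ?U (?k 1 (?k (- \<sigma>) q)) (?k (- 1) (?k (- \<sigma>) p)) False"
  define wzz where "wzz = ?U (?k (- \<sigma>) (?k (- \<sigma>) p)) (?k (- \<sigma>) (?k (- \<sigma>) q)) True"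
  have inner: "\<bar>R - z\<bar> < h" if "z \<in> {r<..<R}" for z using that by (auto simp: h_def)
  have inner': "\<bar>R - z\<bar> < h" if "(y, z) \<in> strip ly r R" for y z
    using that inner by (auto simp: strip_def)
  note cont = mode_series_continuous[OF a(1) \<sigma> _ _ inner']
  have "jet2 ly r R S wy wz wyy wyz wzy wzz"
  proof (rule jet2I)
    have "uniform_limit (rect ly r R) (\<lambda>N v. \<Sum>n<N. fourier_mode ly r R f (Suc n) (fst v) (snd v))
        (\<lambda>v. \<Sum>n. fourier_mode ly r R f (Suc n) (fst v) (snd v)) sequentially"
      by (rule Weierstrass_m_test[OF _ summable_add[OF AB]], rule bound) (auto simp: rect_def)
    moreover have "continuous_on (rect ly r R) (\<lambda>v. \<Sum>n<N. fourier_mode ly r R f (Suc n) (fst v) (snd v))" for N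
      unfolding mode_eq mode_def[OF a(1) \<sigma>] by (auto intro!: continuous_intros)
    ultimately show "continuous_on (rect ly r R) (\<lambda>v. S (fst v) (snd v))"
      unfolding S_def by (intro uniform_limit_theorem[rotated]) auto
    show "((\<lambda>s. S s z) has_real_derivative wy y z) (at y within {-ly..ly})"
      if y: "y \<in> {-ly..ly}" and z: "z \<in> {r..R}" for y z
    proof (cases "z = r")
      case True
      have "((\<lambda>y. f y - m * (r - R)) has_real_derivative f' y - 0) (at y within {-ly..ly})"
        by (intro DERIV_diff f' y) simp
      then have "((\<lambda>s. S s r) has_real_derivative f' y - 0) (at y within {-ly..ly})"
        by (subst has_field_derivative_cong_eventually[where g = "\<lambda>y. f y - m * (r - R)"])
           (auto simp: eventually_at_filter S_r S_r[OF y])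
      then show ?thesis using True by (simp add: wy_def)
    next
      case False
      then have "\<bar>R - z\<bar> < h" using z by (auto simp: h_def)
      from dy[OF pq this] False show ?thesis by (simp add: S wy_def)
    qed
    fix y z assume y: "y \<in> {-ly..ly}" and z: "z \<in> {r<..<R}"
    have zr: "z \<noteq> r" using z by auto
    show "((\<lambda>t. S y t) has_real_derivative wz y z) (at z within {r..R})"
      unfolding S wz_def by (rule dz[OF pq inner[OF z], where b = True, unfolded not_True_eq_False])
    show "((\<lambda>s. wy s z) has_real_derivative wyy y z) (at y within {-ly..ly})"
      unfolding wy_def wyy_def if_not_P[OF zr] by (rule dy[OF adm[OF pq(2)] adm[OF pq(1)] inner[OF z]])
    show "((\<lambda>t. wy y t) has_real_derivative wyz y z) (at z within {r..R})"
    proof (subst has_field_derivative_cong_eventually[where g = "?U (?k 1 q) (?k (- 1) p) True y"])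
      show "\<forall>\<^sub>F t in at z within {r..R}. wy y t = ?U (?k 1 q) (?k (- 1) p) True y t"
        using eventually_neq_at_within[of r z "{r..R}"] by eventually_elim (simp add: wy_def)
      show "((\<lambda>t. ?U (?k 1 q) (?k (- 1) p) True y t) has_real_derivative wyz y z) (at z within {r..R})"
        unfolding wyz_def
        by (rule dz[OF adm[OF pq(2)] adm[OF pq(1)] inner[OF z], where b = True, unfolded not_True_eq_False])
    qed (use zr in \<open>simp add: wy_def\<close>)
    show "((\<lambda>s. wz s z) has_real_derivative wzy y z) (at y within {-ly..ly})"
      unfolding wz_def wzy_def by (rule dy[OF adm[OF pq(1)] adm[OF pq(2)] inner[OF z]])
    show "((\<lambda>t. wz y t) has_real_derivative wzz y z) (at z within {r..R})"
      unfolding wz_def wzz_def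
      by (rule dz[OF adm[OF pq(1)] adm[OF pq(2)] inner[OF z], where b = False, unfolded not_False_eq_True])
  next
    show "continuous_on (strip ly r R) (\<lambda>v. wy (fst v) (snd v))"
      by (rule continuous_on_cong[THEN iffD1, OF refl _ cont[OF adm[OF pq(2), where k = 1]
            adm[OF pq(1), where k = "- 1"], where b = True and c = ly]])
         (auto simp: wy_def strip_def)
    show "continuous_on (strip ly r R) (\<lambda>v. wz (fst v) (snd v))"
      "continuous_on (strip ly r R) (\<lambda>v. wyy (fst v) (snd v))"
      "continuous_on (strip ly r R) (\<lambda>v. wyz (fst v) (snd v))"
      "continuous_on (strip ly r R) (\<lambda>v. wzy (fst v) (snd v))"
      "continuous_on (strip ly r R) (\<lambda>v. wzz (fst v) (snd v))"
      unfolding wz_def wyy_def wyz_def wzy_def wzz_def by (rule cont, intro adm pq, intro adm pq, assumption)+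
  qed
  moreover have "wy (-ly) z = wy ly z" for z
    using per mode_series_periodic[OF a(1) \<sigma> a(2)] by (simp add: wy_def)
  moreover have "wzz y z + (1 + m\<^sup>2) * wyy y z = 0" if "z \<in> {r<..<R}" for y z
    using mode_series_laplace[OF a(1) \<sigma> pq inner[OF that]]
    unfolding wzz_def wyy_def \<sigma>2[symmetric] .
  ultimately show "\<exists>wy wz wyy wyz wzy wzz. jet2 ly r R S wy wz wyy wyz wzy wzz \<and>
      (\<forall>z \<in> {r..R}. wy (-ly) z = wy ly z) \<and>
      (\<forall>y \<in> {-ly..ly}. \<forall>z \<in> {r<..<R}. wzz y z + (1 + m\<^sup>2) * wyy y z = 0)"
    by blast
qed

section \<open>Matching\<close>

text \<open>The difference is \<open>py\<^sup>2 * pzz - 2 * (py * pz * pyz) + (pz\<^sup>2 -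
  m\<^sup>2) * pyy\<close>. Every term has at least two small factors, the last one because
  \<open>pz\<^sup>2 - m\<^sup>2\<close> contains \<open>pz - m\<close>. The first has three, one of
  which is bounded by \<open>P\<close> since \<open>\<eta> \<le> 1\<close>.\<close>

lemma minimal_op_linearization:
  fixes m M P \<eta> py pz pyy pyz pzz :: real
  assumes \<eta>: "0 < \<eta>" "\<eta> \<le> 1" and m: "\<bar>m\<bar> \<le> M"
    and b: "\<bar>py\<bar> \<le> \<eta> * P" "\<bar>pz - m\<bar> \<le> \<eta> * P" "\<bar>pyy\<bar> \<le> \<eta> * P" "\<bar>pyz\<bar> \<le> \<eta> * P" "\<bar>pzz\<bar> \<le> \<eta> * P"
  shows "\<bar>((1 + py\<^sup>2) * pzz - 2 * py * pz * pyz + (1 + pz\<^sup>2) * pyy) - (pzz + (1 + m\<^sup>2) * pyy)\<bar>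
     \<le> \<eta>\<^sup>2 * (P ^ 3 + 2 * (P\<^sup>2 * (M + P)) + P\<^sup>2 * (2 * M + P))"
proof -
  have P: "0 \<le> P" using \<eta>(1) order_trans[OF abs_ge_zero b(1)] by (simp add: zero_le_mult_iff)
  have \<eta>P: "0 \<le> \<eta> * P" "\<eta> * P \<le> P" using \<eta> P mult_right_mono[OF \<eta>(2), of P] by simp_all
  have M: "0 \<le> M" using m by simp
  have pz: "\<bar>pz\<bar> \<le> M + P" "\<bar>pz + m\<bar> \<le> 2 * M + P" using b(2) m \<eta>P by linarith+
  have "\<bar>py\<bar> * \<bar>py\<bar> * \<bar>pzz\<bar> \<le> (\<eta> * P) * (\<eta> * P) * P"
    using b \<eta>P P by (intro mult_mono) auto
  then have 1: "\<bar>py\<^sup>2 * pzz\<bar> \<le> \<eta>\<^sup>2 * P ^ 3"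
    by (simp add: abs_mult power2_eq_square power3_eq_cube mult_ac)
  have "\<bar>py\<bar> * \<bar>pyz\<bar> * \<bar>pz\<bar> \<le> (\<eta> * P) * (\<eta> * P) * (M + P)"
    using b \<eta>P P M pz by (intro mult_mono) auto
  then have 2: "\<bar>py * pz * pyz\<bar> \<le> \<eta>\<^sup>2 * (P\<^sup>2 * (M + P))"
    by (simp add: abs_mult power2_eq_square mult_ac)
  have "\<bar>pz - m\<bar> * \<bar>pyy\<bar> * \<bar>pz + m\<bar> \<le> (\<eta> * P) * (\<eta> * P) * (2 * M + P)"
    using b \<eta>P P M pz by (intro mult_mono) auto
  moreover have "\<bar>(pz\<^sup>2 - m\<^sup>2) * pyy\<bar> = \<bar>pz - m\<bar> * \<bar>pyy\<bar> * \<bar>pz + m\<bar>"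
    unfolding abs_mult[symmetric] by (simp add: power2_eq_square algebra_simps)
  ultimately have 3: "\<bar>(pz\<^sup>2 - m\<^sup>2) * pyy\<bar> \<le> \<eta>\<^sup>2 * (P\<^sup>2 * (2 * M + P))"
    by (simp add: power2_eq_square mult_ac)
  have "((1 + py\<^sup>2) * pzz - 2 * py * pz * pyz + (1 + pz\<^sup>2) * pyy) - (pzz + (1 + m\<^sup>2) * pyy)
      = py\<^sup>2 * pzz - 2 * (py * pz * pyz) + (pz\<^sup>2 - m\<^sup>2) * pyy"
    by (simp add: algebra_simps)
  with 1 2 3 have "\<bar>((1 + py\<^sup>2) * pzz - 2 * py * pz * pyz + (1 + pz\<^sup>2) * pyy) - (pzz + (1 + m\<^sup>2) * pyy)\<bar>
     \<le> \<eta>\<^sup>2 * P ^ 3 + 2 * (\<eta>\<^sup>2 * (P\<^sup>2 * (M + P))) + \<eta>\<^sup>2 * (P\<^sup>2 * (2 * M + P))"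
    by linarith
  then show ?thesis by (simp only: distrib_left mult.left_commute)
qed

lemma C2_bound_iff:
  "C2_bound ly r R w c \<longleftrightarrow>
     (\<forall>y \<in> {-ly..ly}. \<forall>z \<in> {r..R}. \<bar>w y z\<bar> \<le> c \<and> \<bar>Dy ly w y z\<bar> \<le> c) \<and>
     (\<forall>y \<in> {-ly..ly}. \<forall>z \<in> {r<..<R}.
        \<bar>Dz r R w y z\<bar> \<le> c \<and> \<bar>Dy ly (Dy ly w) y z\<bar> \<le> c \<and> \<bar>Dz r R (Dy ly w) y z\<bar> \<le> c \<and>
        \<bar>Dy ly (Dz r R w) y z\<bar> \<le> c \<and> \<bar>Dz r R (Dz r R w) y z\<bar> \<le> c)"
  by (simp add: C2_bound_def rect_def strip_def)

lemma C2_bound_mono: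
  assumes "C2_bound ly r R w c" "c \<le> c'"
  shows "C2_bound ly r R w c'"
  using assms(1) order_trans[OF _ assms(2)] unfolding C2_bound_iff by blast

lemma expansion_derivative_bounds:
  assumes ly: "0 < ly" and rR: "r < R" and x: "C2_strip ly r R x" and u: "C2_strip ly r R u"
    and rem: "C2_bound ly r R (\<lambda>y z. x y z - (m * (z - R) + u y z * \<eta>)) \<epsilon>"
  shows "y \<in> {-ly..ly} \<Longrightarrow> z \<in> {r..R} \<Longrightarrow>
      \<bar>x y z - (m * (z - R) + u y z * \<eta>)\<bar> \<le> \<epsilon> \<and> \<bar>Dy ly x y z - Dy ly u y z * \<eta>\<bar> \<le> \<epsilon>"
    and "y \<in> {-ly..ly} \<Longrightarrow> z \<in> {r<..<R} \<Longrightarrow>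
      \<bar>Dz r R x y z - (m + Dz r R u y z * \<eta>)\<bar> \<le> \<epsilon> \<and>
      \<bar>Dy ly (Dy ly x) y z - Dy ly (Dy ly u) y z * \<eta>\<bar> \<le> \<epsilon> \<and>
      \<bar>Dz r R (Dy ly x) y z - Dz r R (Dy ly u) y z * \<eta>\<bar> \<le> \<epsilon> \<and>
      \<bar>Dz r R (Dz r R x) y z - Dz r R (Dz r R u) y z * \<eta>\<bar> \<le> \<epsilon>"
proof -
  have m: "jet2 ly r R (\<lambda>y z. m * (z - R)) (\<lambda>y z. 0) (\<lambda>y z. m) (\<lambda>y z. 0) (\<lambda>y z. 0) (\<lambda>y z. 0) (\<lambda>y z. 0)"
    by (rule jet2_height) (auto intro!: derivative_eq_intros)
  note j = jet2_derivs[OF ly rR jet2_diff[OF jet2_of_C2_strip[OF x]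
        jet2_add[OF m jet2_mult_right[OF jet2_of_C2_strip[OF u], of \<eta>]]]]
  show "\<bar>x y z - (m * (z - R) + u y z * \<eta>)\<bar> \<le> \<epsilon> \<and> \<bar>Dy ly x y z - Dy ly u y z * \<eta>\<bar> \<le> \<epsilon>"
    if yz: "y \<in> {-ly..ly}" "z \<in> {r..R}"
    using rem[unfolded C2_bound_iff, THEN conjunct1, rule_format, OF yz] unfolding j(1)[OF yz] by simp
  show "\<bar>Dz r R x y z - (m + Dz r R u y z * \<eta>)\<bar> \<le> \<epsilon> \<and>
      \<bar>Dy ly (Dy ly x) y z - Dy ly (Dy ly u) y z * \<eta>\<bar> \<le> \<epsilon> \<and>
      \<bar>Dz r R (Dy ly x) y z - Dz r R (Dy ly u) y z * \<eta>\<bar> \<le> \<epsilon> \<and>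
      \<bar>Dz r R (Dz r R x) y z - Dz r R (Dz r R u) y z * \<eta>\<bar> \<le> \<epsilon>"
    if yz: "y \<in> {-ly..ly}" "z \<in> {r<..<R}"
    using rem[unfolded C2_bound_iff, THEN conjunct2, rule_format, OF yz]
    unfolding j(2)[OF yz] j(3)[OF yz] j(4)[OF yz] j(6)[OF yz] by simp
qed

text \<open>The constant of \<open>minimal_op_linearization\<close> for \<open>P = K + 1\<close>,
  where \<open>K\<close> bounds the profile and 1 accounts for a remainder of size at most
  \<open>\<eta>\<close>.\<close>

definition second_order_const :: "real \<Rightarrow> real \<Rightarrow> real" where
  "second_order_const M K = (K + 1) ^ 3 + 2 * ((K + 1)\<^sup>2 * (M + (K + 1))) + (K + 1)\<^sup>2 * (2 * M + (K + 1))"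

lemma second_order_const_nonneg: "0 \<le> M \<Longrightarrow> 0 \<le> K \<Longrightarrow> 0 \<le> second_order_const M K"
  by (simp add: second_order_const_def)

text \<open>The first estimate keeps the linear operator on \<open>x\<close> itself, so its error is
  purely quadratic; this one drives the error bound for the interface. The second passes on to the
  profile, and the remainder then enters with weight \<open>2 + M\<^sup>2\<close>, that is 1 from
  the \<open>z\<close>-part plus \<open>1 + M\<^sup>2\<close> from the
  \<open>y\<close>-part.\<close>

lemma minimal_op_close:
  assumes ly: "0 < ly" and rR: "r < R" and x: "C2_strip ly r R x" and u: "C2_strip ly r R u"
    and \<eta>: "0 < \<eta>" "\<eta> \<le> 1" and e: "e \<le> 1" and m: "\<bar>m\<bar> \<le> M" and K: "C2_bound ly r R u K"
    and rem: "C2_bound ly r R (\<lambda>y z. x y z - (m * (z - R) + u y z * \<eta>)) (e * \<eta>)"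
    and yz: "y \<in> {-ly..ly}" "z \<in> {r<..<R}"
  shows "\<bar>minimal_op ly r R x y z - linear_op ly r R m x y z\<bar> \<le> \<eta>\<^sup>2 * second_order_const M K"
    and "\<bar>minimal_op ly r R x y z - \<eta> * linear_op ly r R m u y z\<bar>
      \<le> \<eta>\<^sup>2 * second_order_const M K + e * \<eta> * (2 + M\<^sup>2)"
proof -
  have z: "z \<in> {r..R}" using yz by auto
  note b = expansion_derivative_bounds(1)[OF ly rR x u rem yz(1) z, THEN conjunct2]
    expansion_derivative_bounds(2)[OF ly rR x u rem yz, THEN conjunct1]
    expansion_derivative_bounds(2)[OF ly rR x u rem yz, THEN conjunct2, THEN conjunct1]
    expansion_derivative_bounds(2)[OF ly rR x u rem yz, THEN conjunct2, THEN conjunct2, THEN conjunct1]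
    expansion_derivative_bounds(2)[OF ly rR x u rem yz, THEN conjunct2, THEN conjunct2, THEN conjunct2]
  have e\<eta>: "e * \<eta> \<le> \<eta>" using mult_right_mono[OF e, of \<eta>] \<eta> by simp
  have *: "\<bar>d\<bar> \<le> \<eta> * (K + 1)" if "\<bar>d - v * \<eta>\<bar> \<le> e * \<eta>" "\<bar>v\<bar> \<le> K" for d v
  proof -
    have "\<bar>v * \<eta>\<bar> \<le> K * \<eta>" using that(2) \<eta> by (simp add: abs_mult)
    then have "\<bar>d\<bar> \<le> e * \<eta> + K * \<eta>" using that(1) by linarith
    then show ?thesis using e\<eta> by (simp add: algebra_simps)
  qed
  have Ku: "\<bar>Dy ly u y z\<bar> \<le> K" "\<bar>Dz r R u y z\<bar> \<le> K" "\<bar>Dy ly (Dy ly u) y z\<bar> \<le> K"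
    "\<bar>Dz r R (Dy ly u) y z\<bar> \<le> K" "\<bar>Dz r R (Dz r R u) y z\<bar> \<le> K"
    using K[unfolded C2_bound_iff, THEN conjunct1, rule_format, OF yz(1) z]
      K[unfolded C2_bound_iff, THEN conjunct2, rule_format, OF yz] by simp_all
  have "\<bar>(Dz r R x y z - m) - Dz r R u y z * \<eta>\<bar> \<le> e * \<eta>"
    using b(2) by (simp only: diff_diff_add)
  note d = *[OF b(1) Ku(1)] *[OF this Ku(2)] *[OF b(3) Ku(3)] *[OF b(4) Ku(4)] *[OF b(5) Ku(5)]
  show 1: "\<bar>minimal_op ly r R x y z - linear_op ly r R m x y z\<bar> \<le> \<eta>\<^sup>2 * second_order_const M K"
    unfolding minimal_op_def linear_op_def second_order_const_def
    by (rule minimal_op_linearization[OF \<eta> m d])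
  have "\<bar>linear_op ly r R m x y z - \<eta> * linear_op ly r R m u y z\<bar> \<le> e * \<eta> * (2 + M\<^sup>2)"
  proof -
    have "linear_op ly r R m x y z - \<eta> * linear_op ly r R m u y z
       = (Dz r R (Dz r R x) y z - Dz r R (Dz r R u) y z * \<eta>)
         + (1 + m\<^sup>2) * (Dy ly (Dy ly x) y z - Dy ly (Dy ly u) y z * \<eta>)"
      by (simp add: linear_op_def algebra_simps)
    moreover have "\<bar>(1 + m\<^sup>2) * (Dy ly (Dy ly x) y z - Dy ly (Dy ly u) y z * \<eta>)\<bar> \<le> (1 + M\<^sup>2) * (e * \<eta>)"
      unfolding abs_mult
    proof (rule mult_mono)
      have "m\<^sup>2 \<le> M\<^sup>2" using m by (metis abs_ge_zero power2_abs power_mono)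
      then show "\<bar>1 + m\<^sup>2\<bar> \<le> 1 + M\<^sup>2" by simp
      show "\<bar>Dy ly (Dy ly x) y z - Dy ly (Dy ly u) y z * \<eta>\<bar> \<le> e * \<eta>" by (rule b(3))
    qed simp_all
    moreover have "e * \<eta> * (2 + M\<^sup>2) = e * \<eta> + (1 + M\<^sup>2) * (e * \<eta>)"
      by (simp add: algebra_simps)
    ultimately show ?thesis using b(5) by linarith
  qed
  with 1 show "\<bar>minimal_op ly r R x y z - \<eta> * linear_op ly r R m u y z\<bar>
      \<le> \<eta>\<^sup>2 * second_order_const M K + e * \<eta> * (2 + M\<^sup>2)"
    by linarith
qed

section \<open>Estimates along the filter\<close>

lemma interface_expansionE:
  assumes "interface_expansion ly r R F f x u"
  obtains M K where "0 \<le> M" "0 \<le> K"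
    "\<And>e. 0 < e \<Longrightarrow> \<forall>\<^sub>F i in F. periodic_C1 ly (f i) \<and> 0 < amplitude ly r R (f i) \<and> amplitude ly r R (f i) < e \<and>
       C2_strip ly r R (x i) \<and> C2_strip ly r R (u i) \<and> \<bar>slope ly r R (f i)\<bar> \<le> M \<and> C2_bound ly r R (u i) K \<and>
       C2_bound ly r R
          (\<lambda>y z. x i y z - (slope ly r R (f i) * (z - R) + u i y z * amplitude ly r R (f i)))
          (e * amplitude ly r R (f i))"
proof -
  from assms obtain M K where
    1: "\<forall>\<^sub>F i in F. periodic_C1 ly (f i) \<and> 0 < amplitude ly r R (f i) \<and> C2_strip ly r R (x i) \<and> C2_strip ly r R (u i)"
    and 2: "((\<lambda>i. amplitude ly r R (f i)) \<longlongrightarrow> 0) F"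
    and 3: "\<forall>\<^sub>F i in F. \<bar>slope ly r R (f i)\<bar> \<le> M" and 4: "\<forall>\<^sub>F i in F. C2_bound ly r R (u i) K"
    and 5: "\<And>e. 0 < e \<Longrightarrow> \<forall>\<^sub>F i in F. C2_bound ly r R
          (\<lambda>y z. x i y z - (slope ly r R (f i) * (z - R) + u i y z * amplitude ly r R (f i)))
          (e * amplitude ly r R (f i))"
    unfolding interface_expansion_def by blast
  \<comment> \<open>Absolute values make the constants nonnegative even for the trivial filter,
    along which the eventual bounds say nothing about the signs of \<open>M\<close> and
    \<open>K\<close>.\<close>
  have K: "C2_bound ly r R v K \<Longrightarrow> C2_bound ly r R v \<bar>K\<bar>" for v
    by (erule C2_bound_mono) simp
  have "\<forall>\<^sub>F i in F. periodic_C1 ly (f i) \<and> 0 < amplitude ly r R (f i) \<and> amplitude ly r R (f i) < e \<and>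
       C2_strip ly r R (x i) \<and> C2_strip ly r R (u i) \<and> \<bar>slope ly r R (f i)\<bar> \<le> \<bar>M\<bar> \<and> C2_bound ly r R (u i) \<bar>K\<bar> \<and>
       C2_bound ly r R
          (\<lambda>y z. x i y z - (slope ly r R (f i) * (z - R) + u i y z * amplitude ly r R (f i)))
          (e * amplitude ly r R (f i))" if "0 < e" for e
    using 1 3 4 5[OF that] order_tendstoD(2)[OF 2 that]
    by eventually_elim (intro conjI; (elim conjE)?; (rule K)?; simp)
  with that[of "\<bar>M\<bar>" "\<bar>K\<bar>"] show ?thesis by (simp only: abs_ge_zero)
qed

lemma unif_smalloI:
  assumes "\<And>\<epsilon>. 0 < \<epsilon> \<Longrightarrow> \<forall>\<^sub>F i in F. 0 < a i \<and> (\<forall>p \<in> S. \<bar>h i p\<bar> \<le> \<epsilon> * a i)"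
  shows "unif_smallo F a S h"
  unfolding unif_smallo_def uniform_limit_iff
proof (intro allI impI)
  fix \<epsilon> :: real assume "0 < \<epsilon>"
  then have "0 < \<epsilon> / 2" by simp
  from assms[OF this] show "\<forall>\<^sub>F i in F. \<forall>p \<in> S. dist (h i p / a i) 0 < \<epsilon>"
  proof eventually_elim
    case (elim i)
    show ?case
    proof
      fix p assume "p \<in> S"
      then have "\<bar>h i p\<bar> / a i \<le> \<epsilon> / 2" using elim by (simp add: pos_divide_le_eq)
      moreover have "dist (h i p / a i) 0 = \<bar>h i p\<bar> / a i" using elim by simp
      ultimately show "dist (h i p / a i) 0 < \<epsilon>" using \<open>0 < \<epsilon>\<close> by linarith
    qed
  qed
qed

text \<open>Where \<open>h i p\<close> is exactly \<open>- (a i * c)\<close>, its quotient by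
  \<open>a i\<close> is the constant \<open>- c\<close>, which tends to zero along a nontrivial
  filter only if it is zero. The minus sign fits the matching: an exact solution annihilates the
  nonlinear part and leaves minus \<open>\<eta>\<close> times the linear one.\<close>

lemma unif_smallo_proportional:
  assumes F: "F \<noteq> bot" and h: "unif_smallo F a S h" and p: "p \<in> S"
    and ev: "\<forall>\<^sub>F i in F. 0 < a i \<and> h i p = - (a i * c)"
  shows "c = 0"
proof (rule ccontr)
  assume "c \<noteq> 0"
  then have "\<forall>\<^sub>F i in F. \<forall>q \<in> S. dist (h i q / a i) 0 < \<bar>c\<bar>"
    using h unfolding unif_smallo_def uniform_limit_iff by auto
  with ev have "\<forall>\<^sub>F i in F. False"
    by eventually_elim (use p in fastforce)
  with F show False by (simp add: trivial_limit_def)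
qed

lemma leading_order_match_of_expansion:
  assumes ly: "0 < ly" and rR: "r < R" and exp: "interface_expansion ly r R F f x u"
  shows "leading_order_match ly r R F f x u"
proof -
  obtain M K where M: "0 \<le> M" and K: "0 \<le> K"
    and ev: "\<And>e. 0 < e \<Longrightarrow> \<forall>\<^sub>F i in F. periodic_C1 ly (f i) \<and> 0 < amplitude ly r R (f i) \<and> amplitude ly r R (f i) < e \<and>
       C2_strip ly r R (x i) \<and> C2_strip ly r R (u i) \<and> \<bar>slope ly r R (f i)\<bar> \<le> M \<and> C2_bound ly r R (u i) K \<and>
       C2_bound ly r R
          (\<lambda>y z. x i y z - (slope ly r R (f i) * (z - R) + u i y z * amplitude ly r R (f i)))
          (e * amplitude ly r R (f i))"
    by (rule interface_expansionE[OF exp]) (rule that, assumption+)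
  define C where "C = second_order_const M K"
  have C: "0 \<le> C" unfolding C_def by (rule second_order_const_nonneg[OF M K])
  note bd = expansion_derivative_bounds(1)[OF ly rR]
  have ends: "r \<in> {r..R}" "R \<in> {r..R}" "-ly \<in> {-ly..ly}" "ly \<in> {-ly..ly}" using rR ly by auto
  show ?thesis
    unfolding leading_order_match_def Let_def
  proof (intro conjI unif_smalloI)
    fix \<epsilon> :: real assume \<epsilon>: "0 < \<epsilon>"
    \<comment> \<open>As the amplitude is below \<open>e\<close>, the quadratic error is at most
      \<open>e * \<eta> * C\<close>; with the remainder term
      \<open>e * \<eta> * (2 + M\<^sup>2)\<close> the total stays below
      \<open>\<epsilon> * \<eta>\<close>.\<close>
    define e where "e = min 1 (\<epsilon> / (C + 2 + M\<^sup>2))"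
    have pos: "0 < C + 2 + M\<^sup>2" using C zero_le_power2[of M] by linarith
    then have e: "0 < e" "e \<le> 1" using \<epsilon> by (auto simp: e_def)
    have "e \<le> \<epsilon> / (C + 2 + M\<^sup>2)" by (simp add: e_def)
    then have eC: "e * (C + 2 + M\<^sup>2) \<le> \<epsilon>" using pos by (simp add: pos_le_divide_eq)
    show "\<forall>\<^sub>F i in F. 0 < amplitude ly r R (f i) \<and> (\<forall>p \<in> strip ly r R.
        \<bar>case p of (y, z) \<Rightarrow> minimal_op ly r R (x i) y z
           - amplitude ly r R (f i) * linear_op ly r R (slope ly r R (f i)) (u i) y z\<bar>
        \<le> \<epsilon> * amplitude ly r R (f i))"
      using ev[OF e(1)]
    proof eventually_elim
      case (elim i)
      define \<eta> where "\<eta> = amplitude ly r R (f i)"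
      have \<eta>: "0 < \<eta>" "\<eta> < e" using elim by (auto simp: \<eta>_def)
      have "\<bar>minimal_op ly r R (x i) y z - \<eta> * linear_op ly r R (slope ly r R (f i)) (u i) y z\<bar> \<le> \<epsilon> * \<eta>"
        if yz: "y \<in> {-ly..ly}" "z \<in> {r<..<R}" for y z
      proof -
        have "\<bar>minimal_op ly r R (x i) y z - \<eta> * linear_op ly r R (slope ly r R (f i)) (u i) y z\<bar>
           \<le> \<eta>\<^sup>2 * C + e * \<eta> * (2 + M\<^sup>2)"
          unfolding C_def
          by (rule minimal_op_close(2)[OF ly rR _ _ _ _ e(2) _ _ _ yz, of "x i" "u i" \<eta> "slope ly r R (f i)"])
             (use elim \<eta> e in \<open>auto simp: \<eta>_def\<close>)
        also have "\<eta>\<^sup>2 * C \<le> e * \<eta> * C"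
          using \<eta> C by (simp add: power2_eq_square mult_right_mono)
        also have "e * \<eta> * C + e * \<eta> * (2 + M\<^sup>2) = (e * (C + 2 + M\<^sup>2)) * \<eta>"
          by (simp add: algebra_simps)
        also have "\<dots> \<le> \<epsilon> * \<eta>" using eC \<eta> by simp
        finally show ?thesis by simp
      qed
      then show ?case using \<eta> by (auto simp: strip_def \<eta>_def)
    qed
    show "\<forall>\<^sub>F i in F. 0 < amplitude ly r R (f i) \<and> (\<forall>y \<in> {-ly..ly}.
        \<bar>x i y r - f i y - amplitude ly r R (f i) * (u i y r - 1 / amplitude ly r R (f i) *
            (f i y - slope ly r R (f i) * (r - R)))\<bar> \<le> \<epsilon> * amplitude ly r R (f i))"
      using ev[OF \<epsilon>]
    proof eventually_elim
      case (elim i)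
      then have amp: "0 < amplitude ly r R (f i)" and x: "C2_strip ly r R (x i)" and u: "C2_strip ly r R (u i)"
        and rem: "C2_bound ly r R
          (\<lambda>y z. x i y z - (slope ly r R (f i) * (z - R) + u i y z * amplitude ly r R (f i)))
          (\<epsilon> * amplitude ly r R (f i))" by simp_all
      have eq: "x i y r - f i y - amplitude ly r R (f i) * (u i y r - 1 / amplitude ly r R (f i) *
            (f i y - slope ly r R (f i) * (r - R)))
          = x i y r - (slope ly r R (f i) * (r - R) + u i y r * amplitude ly r R (f i))" for y
        using amp by (simp add: right_diff_distrib)
      show ?case
        unfolding eq using amp bd[OF x u rem _ ends(1), THEN conjunct1] by simp
    qed
    show "\<forall>\<^sub>F i in F. 0 < amplitude ly r R (f i) \<and> (\<forall>y \<in> {-ly..ly}.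
        \<bar>x i y R - amplitude ly r R (f i) * u i y R\<bar> \<le> \<epsilon> * amplitude ly r R (f i))"
      using ev[OF \<epsilon>]
    proof eventually_elim
      case (elim i)
      then have amp: "0 < amplitude ly r R (f i)" and x: "C2_strip ly r R (x i)" and u: "C2_strip ly r R (u i)"
        and rem: "C2_bound ly r R
          (\<lambda>y z. x i y z - (slope ly r R (f i) * (z - R) + u i y z * amplitude ly r R (f i)))
          (\<epsilon> * amplitude ly r R (f i))" by simp_all
      show ?case
        using amp bd[OF x u rem _ ends(2), THEN conjunct1] by (simp add: mult.commute)
    qed
    have \<epsilon>2: "0 < \<epsilon> / 2" using \<epsilon> by simp
    \<comment> \<open>Here \<open>k\<close> is the contribution of the plane, equal on both lateral
      sides and therefore cancelling; it is 0 for the \<open>y\<close>-derivatives. Each side brings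
      its own remainder, hence the halves of \<open>\<epsilon>\<close>.\<close>
    have triangle: "\<bar>a - b - \<eta> * (c - d)\<bar> \<le> \<epsilon> * \<eta>"
      if "\<bar>a - (k + c * \<eta>)\<bar> \<le> \<epsilon> / 2 * \<eta>" "\<bar>b - (k + d * \<eta>)\<bar> \<le> \<epsilon> / 2 * \<eta>" for a b c d k \<eta> :: real
    proof -
      have "a - b - \<eta> * (c - d) = (a - (k + c * \<eta>)) - (b - (k + d * \<eta>))"
        by (simp add: algebra_simps)
      then show ?thesis using that by linarith
    qed
    show "\<forall>\<^sub>F i in F. 0 < amplitude ly r R (f i) \<and> (\<forall>z \<in> {r..R}.
        \<bar>x i (-ly) z - x i ly z - amplitude ly r R (f i) * (u i (-ly) z - u i ly z)\<bar>
          \<le> \<epsilon> * amplitude ly r R (f i))"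
      using ev[OF \<epsilon>2]
    proof eventually_elim
      case (elim i)
      then have amp: "0 < amplitude ly r R (f i)" and x: "C2_strip ly r R (x i)" and u: "C2_strip ly r R (u i)"
        and rem: "C2_bound ly r R
          (\<lambda>y z. x i y z - (slope ly r R (f i) * (z - R) + u i y z * amplitude ly r R (f i)))
          (\<epsilon> / 2 * amplitude ly r R (f i))" by simp_all
      note bd' = bd[OF x u rem]
      show ?case
        by (intro conjI ballI amp triangle[OF bd'[OF ends(3), THEN conjunct1] bd'[OF ends(4), THEN conjunct1]])
    qed
    show "\<forall>\<^sub>F i in F. 0 < amplitude ly r R (f i) \<and> (\<forall>z \<in> {r..R}.
        \<bar>Dy ly (x i) (-ly) z - Dy ly (x i) ly z - amplitude ly r R (f i) * (Dy ly (u i) (-ly) z - Dy ly (u i) ly z)\<bar>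
          \<le> \<epsilon> * amplitude ly r R (f i))"
      using ev[OF \<epsilon>2]
    proof eventually_elim
      case (elim i)
      then have amp: "0 < amplitude ly r R (f i)" and x: "C2_strip ly r R (x i)" and u: "C2_strip ly r R (u i)"
        and rem: "C2_bound ly r R
          (\<lambda>y z. x i y z - (slope ly r R (f i) * (z - R) + u i y z * amplitude ly r R (f i)))
          (\<epsilon> / 2 * amplitude ly r R (f i))" by simp_all
      note bd' = bd[OF x u rem]
      have "\<bar>Dy ly (x i) y z - (0 + Dy ly (u i) y z * amplitude ly r R (f i))\<bar> \<le> \<epsilon> / 2 * amplitude ly r R (f i)"
        if "y \<in> {-ly..ly}" "z \<in> {r..R}" for y z
        using bd'[OF that, THEN conjunct2] by (simp only: add_0_left)
      from triangle[OF this[OF ends(3)] this[OF ends(4)]] amp show ?case by blast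
    qed
  qed
qed

text \<open>With \<open>x i\<close> an exact solution and the limiting data fixed, every matched
  expression equals \<open>\<eta>\<close> times a residual independent of \<open>i\<close>, and
  being \<open>o(\<eta>)\<close> forces that residual to vanish.\<close>

lemma linear_system_of_exact_match:
  assumes ly: "0 < ly" and rR: "r < R" and F: "F \<noteq> bot" and exp: "interface_expansion ly r R F f x u"
    and min: "\<forall>\<^sub>F i in F. minimal_system ly r R (f i) (x i)"
    and const: "\<forall>\<^sub>F i in F. slope ly r R (f i) = m0 \<and> u i = u0 \<and>
           (\<forall>y \<in> {-ly..ly}. f i y = m0 * (r - R) + amplitude ly r R (f i) * \<phi> y)"
  shows "\<forall>\<^sub>F i in F. linear_system ly r R (f i) u0"
proof -
  have reg: "\<forall>\<^sub>F i in F. 0 < amplitude ly r R (f i) \<and> C2_strip ly r R (u i)"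
    using exp unfolding interface_expansion_def by (auto elim: eventually_mono)
  note ev = eventually_conj[OF reg eventually_conj[OF min const]]
  note match = leading_order_match_of_expansion[OF ly rR exp, unfolded leading_order_match_def Let_def]
  have eq: "linear_op ly r R m0 u0 y z = 0" if "(y, z) \<in> strip ly r R" for y z
    by (rule unif_smallo_proportional[OF F match[THEN conjunct1] that])
       (rule eventually_mono[OF ev], use that in \<open>auto simp: minimal_system_def\<close>)
  have bot: "u0 y r - \<phi> y = 0" if "y \<in> {-ly..ly}" for y
    by (rule unif_smallo_proportional[OF F match[THEN conjunct2, THEN conjunct1] that])
       (rule eventually_mono[OF ev], use that in \<open>auto simp: minimal_system_def\<close>)
  have top: "u0 y R = 0" if "y \<in> {-ly..ly}" for y
    by (rule unif_smallo_proportional[OF F match[THEN conjunct2, THEN conjunct2, THEN conjunct1] that])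
       (rule eventually_mono[OF ev], use that in \<open>auto simp: minimal_system_def\<close>)
  have per: "u0 (-ly) z - u0 ly z = 0" if "z \<in> {r..R}" for z
    by (rule unif_smallo_proportional[OF F match[THEN conjunct2, THEN conjunct2, THEN conjunct2, THEN conjunct1] that])
       (rule eventually_mono[OF ev], use that in \<open>auto simp: minimal_system_def\<close>)
  have per': "Dy ly u0 (-ly) z - Dy ly u0 ly z = 0" if "z \<in> {r..R}" for z
    by (rule unif_smallo_proportional[OF F match[THEN conjunct2, THEN conjunct2, THEN conjunct2, THEN conjunct2] that])
       (rule eventually_mono[OF ev], use that in \<open>auto simp: minimal_system_def\<close>)
  from ev show ?thesis
  proof eventually_elim
    case (elim i)
    have "u0 y r = 1 / amplitude ly r R (f i) * (f i y - slope ly r R (f i) * (r - R))" if "y \<in> {-ly..ly}" for y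
      using elim bot[OF that] that by simp
    then show ?case
      unfolding linear_system_def using elim eq top per per' by auto
  qed
qed

section \<open>The Fourier solution and its distance from the interface\<close>

lemma fourier_u_solves:
  assumes ly: "0 < ly" and rR: "r < R" and f: "periodic_C1 ly f" and amp: "0 < amplitude ly r R f"
  shows "linear_system ly r R f (fourier_u ly r R f)"
proof -
  let ?S = "\<lambda>y z. \<Sum>n. fourier_mode ly r R f (Suc n) y z"
  note sol = fourier_solution[OF ly rR f]
  obtain wy wz wyy wyz wzy wzz where j: "jet2 ly r R ?S wy wz wyy wyz wzy wzz"
    and per: "\<And>z. z \<in> {r..R} \<Longrightarrow> wy (-ly) z = wy ly z"
    and eq: "\<And>y z. y \<in> {-ly..ly} \<Longrightarrow> z \<in> {r<..<R} \<Longrightarrow> wzz y z + (1 + (slope ly r R f)\<^sup>2) * wyy y z = 0"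
    using sol(5) by blast
  have u: "fourier_u ly r R f = (\<lambda>y z. ?S y z * (1 / amplitude ly r R f))"
    by (simp add: fourier_u_def[abs_def])
  note d = jet2_derivs[OF ly rR jet2_mult_right[OF j, of "1 / amplitude ly r R f"], folded u]
  show ?thesis
    unfolding linear_system_def
  proof (intro conjI ballI)
    show "C2_strip ly r R (fourier_u ly r R f)" by (rule d(7))
    show "case p of (y, z) \<Rightarrow> linear_op ly r R (slope ly r R f) (fourier_u ly r R f) y z = 0"
      if in_strip: "p \<in> strip ly r R" for p
    proof -
      obtain y z where p: "p = (y, z)" "y \<in> {-ly..ly}" "z \<in> {r<..<R}" using in_strip by (auto simp: strip_def)
      have "linear_op ly r R (slope ly r R f) (fourier_u ly r R f) y z
          = (wzz y z + (1 + (slope ly r R f)\<^sup>2) * wyy y z) * (1 / amplitude ly r R f)"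
        unfolding linear_op_def d(6)[OF p(2,3)] d(3)[OF p(2,3)] by (simp add: algebra_simps)
      then show ?thesis using eq[OF p(2,3)] p(1) by simp
    qed
    show "fourier_u ly r R f y r = 1 / amplitude ly r R f * (f y - slope ly r R f * (r - R))"
      if "y \<in> {-ly..ly}" for y
      unfolding fourier_u_def sol(2)[OF that] ..
    show "fourier_u ly r R f y R = 0" for y
      unfolding fourier_u_def sol(3) by simp
    show "fourier_u ly r R f (-ly) z = fourier_u ly r R f ly z" for z
      unfolding fourier_u_def sol(4) ..
    show "Dy ly (fourier_u ly r R f) (-ly) z = Dy ly (fourier_u ly r R f) ly z" if "z \<in> {r..R}" for z
      using ly that per[OF that] by (simp add: d(1))
  qed
qed

lemma interface_fourier_error:
  assumes ly: "0 < ly" and rR: "r < R" and f: "periodic_C1 ly f" and min: "minimal_system ly r R f x"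
    and e: "0 < e"
    and L: "\<And>y z. y \<in> {-ly..ly} \<Longrightarrow> z \<in> {r<..<R} \<Longrightarrow> \<bar>linear_op ly r R (slope ly r R f) x y z\<bar> \<le> e"
    and yz: "y \<in> {-ly..ly}" "z \<in> {r..R}"
  shows "\<bar>x y z - (slope ly r R f * (z - R) + (\<Sum>n. fourier_mode ly r R f (Suc n) y z))\<bar> \<le> e * (R - r)\<^sup>2"
proof -
  define m where "m = slope ly r R f"
  let ?S = "\<lambda>y z. \<Sum>n. fourier_mode ly r R f (Suc n) y z"
  note sol = fourier_solution[OF ly rR f, folded m_def]
  obtain wy wz wyy wyz wzy wzz where j: "jet2 ly r R ?S wy wz wyy wyz wzy wzz"
    and per: "\<And>z. z \<in> {r..R} \<Longrightarrow> wy (-ly) z = wy ly z"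
    and eq: "\<And>y z. y \<in> {-ly..ly} \<Longrightarrow> z \<in> {r<..<R} \<Longrightarrow> wzz y z + (1 + m\<^sup>2) * wyy y z = 0"
    using sol(5) by blast
  have x: "C2_strip ly r R x" "\<And>y. y \<in> {-ly..ly} \<Longrightarrow> x y r = f y" "\<And>y. y \<in> {-ly..ly} \<Longrightarrow> x y R = 0"
    "\<And>z. z \<in> {r..R} \<Longrightarrow> x (-ly) z = x ly z" "\<And>z. z \<in> {r..R} \<Longrightarrow> Dy ly x (-ly) z = Dy ly x ly z"
    using min by (auto simp: minimal_system_def)
  have h: "jet2 ly r R (\<lambda>y z. m * (z - R)) (\<lambda>y z. 0) (\<lambda>y z. m) (\<lambda>y z. 0) (\<lambda>y z. 0) (\<lambda>y z. 0) (\<lambda>y z. 0)"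
    by (rule jet2_height) (auto intro!: derivative_eq_intros)
  have sub: "z \<in> {r..R}" if "z \<in> {r<..<R}" for z using that by auto
  have "\<bar>x y z - (m * (z - R) + ?S y z)\<bar> \<le> e * (R - r)\<^sup>2"
  proof (rule maximum_principle_bound[OF ly rR _ e jet2_diff[OF jet2_of_C2_strip[OF x(1)] jet2_add[OF h j]] _ _ _ _ _ yz,
        where \<kappa> = "1 + m\<^sup>2"])
    show "x (-ly) z - (m * (z - R) + ?S (-ly) z) = x ly z - (m * (z - R) + ?S ly z)" if "z \<in> {r<..<R}" for z
      unfolding x(4)[OF sub[OF that]] sol(4) ..
    show "Dy ly x (-ly) z - (0 + wy (-ly) z) = Dy ly x ly z - (0 + wy ly z)" if "z \<in> {r<..<R}" for z
      unfolding x(5)[OF sub[OF that]] per[OF sub[OF that]] ..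
    show "x y r - (m * (r - R) + ?S y r) = 0" if "y \<in> {-ly..ly}" for y
      unfolding x(2)[OF that] sol(2)[OF that] by simp
    show "x y R - (m * (R - R) + ?S y R) = 0" if "y \<in> {-ly..ly}" for y
      unfolding x(3)[OF that] sol(3) by simp
    show "\<bar>Dz r R (Dz r R x) y z - (0 + wzz y z) + (1 + m\<^sup>2) * (Dy ly (Dy ly x) y z - (0 + wyy y z))\<bar> \<le> e"
      if "y \<in> {-ly..ly}" "z \<in> {r<..<R}" for y z
    proof -
      have "Dz r R (Dz r R x) y z - (0 + wzz y z) + (1 + m\<^sup>2) * (Dy ly (Dy ly x) y z - (0 + wyy y z))
        = linear_op ly r R m x y z - (wzz y z + (1 + m\<^sup>2) * wyy y z)"
        by (simp add: linear_op_def algebra_simps)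
      then show ?thesis using L[OF that] eq[OF that] by (simp add: m_def)
    qed
  qed (simp add: add_nonneg_nonneg)
  then show ?thesis by (simp add: m_def)
qed

lemma interface_asymptotics:
  assumes ly: "0 < ly" and rR: "r < R" and exp: "interface_expansion ly r R F f x u"
    and min: "\<forall>\<^sub>F i in F. minimal_system ly r R (f i) (x i)"
  shows "unif_smallo F (\<lambda>i. amplitude ly r R (f i)) (rect ly r R)
          (\<lambda>i (y, z). x i y z
             - (slope ly r R (f i) * (z - R) + (\<Sum>n. fourier_mode ly r R (f i) (Suc n) y z)))"
proof (rule unif_smalloI)
  obtain M K where M: "0 \<le> M" and K: "0 \<le> K"
    and ev: "\<And>e. 0 < e \<Longrightarrow> \<forall>\<^sub>F i in F. periodic_C1 ly (f i) \<and> 0 < amplitude ly r R (f i) \<and> amplitude ly r R (f i) < e \<and>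
       C2_strip ly r R (x i) \<and> C2_strip ly r R (u i) \<and> \<bar>slope ly r R (f i)\<bar> \<le> M \<and> C2_bound ly r R (u i) K \<and>
       C2_bound ly r R
          (\<lambda>y z. x i y z - (slope ly r R (f i) * (z - R) + u i y z * amplitude ly r R (f i)))
          (e * amplitude ly r R (f i))"
    by (rule interface_expansionE[OF exp]) (rule that, assumption+)
  \<comment> \<open>The added 1 makes the bound strictly positive, as the maximum principle requires
    for its barrier.\<close>
  define C where "C = second_order_const M K + 1"
  have C: "0 < C" using second_order_const_nonneg[OF M K] by (simp add: C_def)
  fix \<epsilon> :: real assume \<epsilon>: "0 < \<epsilon>"
  \<comment> \<open>The error will be \<open>\<eta>\<^sup>2 * C * (R - r)\<^sup>2\<close>; one
    factor \<open>\<eta>\<close> below this \<open>e\<close> brings it under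
    \<open>\<epsilon> * \<eta>\<close>. The cap at 1 also provides \<open>\<eta> \<le> 1\<close> for
    the linearization.\<close>
  define e where "e = min 1 (\<epsilon> / (C * (R - r)\<^sup>2))"
  have pos: "0 < C * (R - r)\<^sup>2" using C rR by simp
  then have e: "0 < e" "e \<le> 1" using \<epsilon> by (auto simp: e_def)
  have "e \<le> \<epsilon> / (C * (R - r)\<^sup>2)" by (simp add: e_def)
  then have eC: "e * (C * (R - r)\<^sup>2) \<le> \<epsilon>" using pos by (simp add: pos_le_divide_eq)
  from eventually_conj[OF ev[OF e(1)] min]
  show "\<forall>\<^sub>F i in F. 0 < amplitude ly r R (f i) \<and> (\<forall>p \<in> rect ly r R.
        \<bar>case p of (y, z) \<Rightarrow> x i y z
             - (slope ly r R (f i) * (z - R) + (\<Sum>n. fourier_mode ly r R (f i) (Suc n) y z))\<bar>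
        \<le> \<epsilon> * amplitude ly r R (f i))"
  proof eventually_elim
    case (elim i)
    define \<eta> where "\<eta> = amplitude ly r R (f i)"
    have \<eta>: "0 < \<eta>" "\<eta> < e" using elim by (auto simp: \<eta>_def)
    have L: "\<bar>linear_op ly r R (slope ly r R (f i)) (x i) y z\<bar> \<le> \<eta>\<^sup>2 * C"
      if yz: "y \<in> {-ly..ly}" "z \<in> {r<..<R}" for y z
    proof -
      have "minimal_op ly r R (x i) y z = 0"
        using elim yz by (auto simp: minimal_system_def strip_def)
      moreover have "\<bar>minimal_op ly r R (x i) y z - linear_op ly r R (slope ly r R (f i)) (x i) y z\<bar>
          \<le> \<eta>\<^sup>2 * second_order_const M K"
        by (rule minimal_op_close(1)[OF ly rR _ _ _ _ e(2) _ _ _ yz, of "x i" "u i" \<eta> "slope ly r R (f i)"])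
           (use elim \<eta> e in \<open>auto simp: \<eta>_def\<close>)
      moreover have "\<eta>\<^sup>2 * C = \<eta>\<^sup>2 * second_order_const M K + \<eta>\<^sup>2"
        by (simp add: C_def distrib_left)
      ultimately show ?thesis using zero_le_power2[of \<eta>] by linarith
    qed
    have "\<bar>x i y z - (slope ly r R (f i) * (z - R) + (\<Sum>n. fourier_mode ly r R (f i) (Suc n) y z))\<bar> \<le> \<epsilon> * \<eta>"
      if yz: "y \<in> {-ly..ly}" "z \<in> {r..R}" for y z
    proof -
      have "\<bar>x i y z - (slope ly r R (f i) * (z - R) + (\<Sum>n. fourier_mode ly r R (f i) (Suc n) y z))\<bar>
          \<le> \<eta>\<^sup>2 * C * (R - r)\<^sup>2"
        by (rule interface_fourier_error[OF ly rR _ _ _ L yz]) (use elim \<eta> C in auto)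
      also have "\<dots> = \<eta> * (C * (R - r)\<^sup>2) * \<eta>" by (simp add: power2_eq_square)
      also have "\<dots> \<le> e * (C * (R - r)\<^sup>2) * \<eta>"
        using \<eta> pos by (intro mult_right_mono) auto
      also have "\<dots> \<le> \<epsilon> * \<eta>" using eC \<eta> by simp
      finally show ?thesis .
    qed
    then show ?case using \<eta> by (auto simp: rect_def \<eta>_def)
  qed
qed

theorem theorem2:
  fixes ly r R :: real
    and F :: "'i filter"
    and f :: "'i \<Rightarrow> real \<Rightarrow> real"
    and x u :: "'i \<Rightarrow> real \<Rightarrow> real \<Rightarrow> real"
  assumes "0 < ly" and "0 < r" and "r < R"
  shows
    \<comment> \<open>the minimal surface system is approximated at leading order by the linear system\<close>
    "(interface_expansion ly r R F f x u \<longrightarrow> leading_order_match ly r R F f x u) \<and>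
    \<comment> \<open>if \<open>m\<close>, \<open>u\<close> and the normalized trace do not vary with \<open>\<eta>\<close>, matching is exact\<close>
     (\<forall>m0 \<phi> u0.
        F \<noteq> bot \<and> interface_expansion ly r R F f x u \<and>
        (\<forall>\<^sub>F i in F. minimal_system ly r R (f i) (x i)) \<and>
        (\<forall>\<^sub>F i in F. slope ly r R (f i) = m0 \<and> u i = u0 \<and>
           (\<forall>y \<in> {-ly..ly}. f i y = m0 * (r - R) + amplitude ly r R (f i) * \<phi> y)) \<longrightarrow>
        (\<forall>\<^sub>F i in F. linear_system ly r R (f i) u0)) \<and>
    \<comment> \<open>the linear system is solved by the Fourier series\<close>
     (\<forall>f0. periodic_C1 ly f0 \<and> 0 < amplitude ly r R f0 \<longrightarrow>
        (\<forall>(y, z) \<in> rect ly r R. summable (\<lambda>n. fourier_mode ly r R f0 (Suc n) y z)) \<and>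
        linear_system ly r R f0 (fourier_u ly r R f0) \<and>
        (\<forall>(y, z) \<in> rect ly r R.
           slope ly r R f0 * (z - R) + amplitude ly r R f0 * fourier_u ly r R f0 y z
           = slope ly r R f0 * (z - R) + (\<Sum>n. fourier_mode ly r R f0 (Suc n) y z))) \<and>
    \<comment> \<open>at leading order the interface is given by the Fourier series\<close>
     (interface_expansion ly r R F f x u \<and>
      (\<forall>\<^sub>F i in F. minimal_system ly r R (f i) (x i)) \<longrightarrow>
        unif_smallo F (\<lambda>i. amplitude ly r R (f i)) (rect ly r R)
          (\<lambda>i (y, z). x i y z
             - (slope ly r R (f i) * (z - R) + (\<Sum>n. fourier_mode ly r R (f i) (Suc n) y z))))"
proof (intro conjI allI impI, goal_cases)
  note ly = assms(1) and rR = assms(3)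
  {
    case 1
    then show ?case by (rule leading_order_match_of_expansion[OF ly rR])
  next
    case (2 m0 \<phi> u0)
    then show ?case by (elim conjE) (rule linear_system_of_exact_match[OF ly rR])
  next
    case (3 f0)
    then show ?case using fourier_solution(1)[OF ly rR] by (auto simp: rect_def)
  next
    case (4 f0)
    then show ?case by (elim conjE) (rule fourier_u_solves[OF ly rR])
  next
    case (5 f0)
    then show ?case by (auto simp: fourier_u_def)
  next
    case 6
    then show ?case by (elim conjE) (rule interface_asymptotics[OF ly rR])
  }
qed

end
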